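(* Let $\{w(i)\}_{i=0}^{\infty}$ be a bounded sequence of nonnegative real numbers, and let $S_w$ be the unilateral weighted shift operator on $H^{2}(\mathbb{D})$ given by $S_w(z^{i})=w(i)z^{i+1}$, $i\ge 0$. For $n\ge 1$ let $C^{+}_{2n}(x)$, $C^{-}_{2n}(x)$, $G^{+}_{2n+1}(x)$, $G^{-}_{2n+1}(x)$ be the polynomials associated with $w$ that are defined in the context, and denote their roots, counted with multiplicity, by $$\mathrm{root}\left(C^{+}_{2n}(x)\right)=\{p_{i}^{(2n)}:1\le i\le n\},\qquad \mathrm{root}\left(C^{-}_{2n}(x)\right)=\{q_{i}^{(2n)}:1\le i\le n\},$$ $$\mathrm{root}\left(G^{+}_{2n+1}(x)\right)=\{p_{i}^{(2n+1)}:1\le i\le n+1\},\qquad \mathrm{root}\left(G^{-}_{2n+1}(x)\right)=\{q_{i}^{(2n+1)}:1\le i\le n\}.$$ Then, as multisets (eigenvalues repeated according to multiplicity), $$\sigma_{p}(S_w\odot S_w^{*})=\left\{\left\{p_{i}^{(j)}:j\ge 2\ \text{and}\ 1\le i\le \left\lfloor\tfrac{j+1}{2}\right\rfloor\right\}\right\}\cup\{0\},$$ $$\sigma_{p}(S_w\wedge S_w^{*})=\left\{\left\{q_{i}^{(j)}:j\ge 2\ \text{and}\ 1\le i\le\left\lfloor\tfrac{j}{2}\right\rfloor\right\}\right\}.$$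
   Context: Here $H^2(\mathbb{D})$ is the Hardy space on the open unit disc, with orthonormal basis $1,z,z^2,\dots$, and $\sigma_p(T)$ denotes the point spectrum (set of eigenvalues) of a bounded operator $T$. Double braces $\{\{\cdot\}\}$ denote a multiset, i.e. a set that permits multiplicity (infinite multiplicities are possible); in the statement $\sigma_p$ is regarded as a multiset in which each eigenvalue is repeated according to the dimension of its eigenspace, and the union with $\{0\}$ adjoins one further copy of $0$. Symmetric and antisymmetric tensor products. For a Hilbert space $\mathcal{H}$, let $\mathcal{H}\otimes\mathcal{H}$ be the Hilbert space tensor product and let $F$ be the flip, the bounded linear map with $F(u\otimes v)=v\otimes u$. Set $\mathcal{H}\odot\mathcal{H}=\{x\in\mathcal{H}\otimes\mathcal{H}:Fx=x\}$ and $\mathcal{H}\wedge\mathcal{H}=\{x\in\mathcal{H}\otimes\mathcal{H}:Fx=-x\}$. For bounded operators $A,B$ on $\mathcal{H}$, $A\odot B$ and $A\wedge B$ are the restrictions of $\frac12(A\otimes B+B\otimes A)$ to the invariant subspaces $\mathcal{H}\odot\mathcal{H}$ and $\mathcal{H}\wedge\mathcal{H}$ respectively. Polynomials. For $n\ge 1$ define inductively $$D^{(n)}_{0}(x)=1,\quad D^{(n)}_{1}(x)=x,\quad D^{(n)}_{2}(x)=x^{2}-\tfrac14 w^{2}(0)w^{2}(2n-2)\ (n\ge 2),$$ $$D^{(n)}_{m}(x)=xD^{(n)}_{m-1}(x)-\tfrac14 w^{2}(m-2)w^{2}(2n-m)D^{(n)}_{m-2}(x),\quad 3\le m\le n,$$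 $$K^{(n)}_{0}(x)=1,\quad K^{(n)}_{1}(x)=x,\quad K^{(n)}_{2}(x)=x^{2}-\tfrac14 w^{2}(0)w^{2}(2n-1)\ (n\ge 2),$$ $$K^{(n)}_{m}(x)=xK^{(n)}_{m-1}(x)-\tfrac14 w^{2}(m-2)w^{2}(2n-m+1)K^{(n)}_{m-2}(x),\quad 3\le m\le n.$$ Then $$C^{\pm}_{2n}(x)=\left(x\mp\tfrac12 w^{2}(n-1)\right)D^{(n)}_{n-1}(x)-\tfrac14 w^{2}(n-2)w^{2}(n)D^{(n)}_{n-2}(x),$$ where for $n=1$ the last term is omitted (so $C^{\pm}_{2}(x)=x\mp\frac12w^2(0)$), and $$G^{+}_{2n+1}(x)=xK^{(n)}_{n}(x)-\tfrac12 w^{2}(n-1)w^{2}(n)K^{(n)}_{n-1}(x),\qquad G^{-}_{2n+1}(x)=K^{(n)}_{n}(x).$$ Equivalently: $C^{\pm}_{2n}$ is the characteristic polynomial of the $n\times n$ symmetric tridiagonal matrix with off-diagonal entries $\frac{w(i)w(2n-2-i)}{2}$, $i=0,\dots,n-2$, and diagonal $(0,\dots,0,\pm\frac{w(n-1)^2}{2})$; $G^{+}_{2n+1}$ is the characteristic polynomial of the $(n+1)\times(n+1)$ symmetric tridiagonal matrix with zero diagonal and off-diagonal entries $\frac{w(i)w(2n-1-i)}{2}$, $i=0,\dots,n-2$, followed by $\frac{\sqrt2\,w(n-1)w(n)}{2}$; $G^{-}_{2n+1}$ is the characteristic polynomial of the $n\times n$ symmetric tridiagonal matrix with zero diagonal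 and off-diagonal entries $\frac{w(i)w(2n-1-i)}{2}$, $i=0,\dots,n-2$. *)

theory Defs
  imports
    "HOL-Complex_Analysis.Complex_Analysis"
    "HOL-Library.Extended_Nat"
begin

section \<open>Complex Hilbert spaces\<close>

text \<open>The inner product is linear in its first argument.\<close>

class complex_hilbert = banach +
  fixes scaleC :: "complex \<Rightarrow> 'a \<Rightarrow> 'a"
    and cinner :: "'a \<Rightarrow> 'a \<Rightarrow> complex"
  assumes scaleC_add_right: "scaleC c (x + y) = scaleC c x + scaleC c y"
    and scaleC_add_left: "scaleC (c + d) x = scaleC c x + scaleC d x"
    and scaleC_scaleC: "scaleC c (scaleC d x) = scaleC (c * d) x"
    and scaleC_one: "scaleC 1 x = x"
    and scaleR_scaleC: "scaleR r x = scaleC (complex_of_real r) x"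
    and cinner_commute: "cinner x y = cnj (cinner y x)"
    and cinner_add_left: "cinner (x + y) z = cinner x z + cinner y z"
    and cinner_scaleC_left: "cinner (scaleC c x) y = c * cinner x y"
    and cinner_norm: "cinner x x = complex_of_real ((norm x)\<^sup>2)"

global_interpretation cvec: vector_space "scaleC :: complex \<Rightarrow> 'a::complex_hilbert \<Rightarrow> 'a"
  by unfold_locales (simp_all add: scaleC_add_right scaleC_add_left scaleC_scaleC scaleC_one)

text \<open>Complex dimension of a linear subspace, with all infinite dimensions identified.\<close>

definition cdimension :: "'a::complex_hilbert set \<Rightarrow> enat" where
  "cdimension V =
     (if \<exists>B. finite B \<and> V \<subseteq> cvec.span B then enat (cvec.dim V) else \<infinity>)"

definition bounded_clinear :: "('a::complex_hilbert \<Rightarrow> 'b::complex_hilbert) \<Rightarrow> bool" where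
  "bounded_clinear A \<longleftrightarrow> bounded_linear A \<and> (\<forall>c x. A (scaleC c x) = scaleC c (A x))"

definition adjoint_op :: "('a::complex_hilbert \<Rightarrow> 'a) \<Rightarrow> 'a \<Rightarrow> 'a" where
  "adjoint_op A = (THE B. bounded_clinear B \<and> (\<forall>x y. cinner (A x) y = cinner x (B y)))"


section \<open>Symmetric and antisymmetric tensor products\<close>

text \<open>
  A Hilbert space tensor product of two Hilbert spaces, given by its elementary tensors
  \<open>tns u v\<close>. These data are unique up to a unitary map that respects elementary tensors.
\<close>

definition hilbert_tensor ::
    "('a::complex_hilbert \<Rightarrow> 'b::complex_hilbert \<Rightarrow> 't::complex_hilbert) \<Rightarrow> bool" where
  "hilbert_tensor tns \<longleftrightarrow>
     (\<forall>u u' v. tns (u + u') v = tns u v + tns u' v) \<and>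
     (\<forall>u v v'. tns u (v + v') = tns u v + tns u v') \<and>
     (\<forall>c u v. tns (scaleC c u) v = scaleC c (tns u v)) \<and>
     (\<forall>c u v. tns u (scaleC c v) = scaleC c (tns u v)) \<and>
     (\<forall>u v u' v'. cinner (tns u v) (tns u' v') = cinner u u' * cinner v v') \<and>
     closure (cvec.span {tns u v | u v. True}) = UNIV"

definition tensor_op ::
    "('a::complex_hilbert \<Rightarrow> 'a \<Rightarrow> 't::complex_hilbert) \<Rightarrow> ('a \<Rightarrow> 'a) \<Rightarrow> ('a \<Rightarrow> 'a) \<Rightarrow> 't \<Rightarrow> 't" where
  "tensor_op tns A B =
     (THE T. bounded_clinear T \<and> (\<forall>u v. T (tns u v) = tns (A u) (B v)))"

definition flip_op :: "('a::complex_hilbert \<Rightarrow> 'a \<Rightarrow> 't::complex_hilbert) \<Rightarrow> 't \<Rightarrow> 't" where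
  "flip_op tns = (THE F. bounded_clinear F \<and> (\<forall>u v. F (tns u v) = tns v u))"

definition sym_space :: "('a::complex_hilbert \<Rightarrow> 'a \<Rightarrow> 't::complex_hilbert) \<Rightarrow> 't set" where
  "sym_space tns = {x. flip_op tns x = x}"

definition antisym_space :: "('a::complex_hilbert \<Rightarrow> 'a \<Rightarrow> 't::complex_hilbert) \<Rightarrow> 't set" where
  "antisym_space tns = {x. flip_op tns x = - x}"

definition sym_op ::
    "('a::complex_hilbert \<Rightarrow> 'a \<Rightarrow> 't::complex_hilbert) \<Rightarrow> ('a \<Rightarrow> 'a) \<Rightarrow> ('a \<Rightarrow> 'a) \<Rightarrow> 't \<Rightarrow> 't" where
  "sym_op tns A B =
     restrict (\<lambda>x. scaleC (1/2) (tensor_op tns A B x + tensor_op tns B A x)) (sym_space tns)"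

definition antisym_op ::
    "('a::complex_hilbert \<Rightarrow> 'a \<Rightarrow> 't::complex_hilbert) \<Rightarrow> ('a \<Rightarrow> 'a) \<Rightarrow> ('a \<Rightarrow> 'a) \<Rightarrow> 't \<Rightarrow> 't" where
  "antisym_op tns A B =
     restrict (\<lambda>x. scaleC (1/2) (tensor_op tns A B x + tensor_op tns B A x)) (antisym_space tns)"


section \<open>Multisets with possibly infinite multiplicities\<close>

text \<open>Such a multiset is represented by its multiplicity function.\<close>

type_synonym 'a emultiset = "'a \<Rightarrow> enat"

definition ecard :: "'a set \<Rightarrow> enat" where
  "ecard A = (if finite A then enat (card A) else \<infinity>)"

text \<open>The multiset \<open>{{f i : i \<in> I}}\<close>.\<close>

definition family_emset :: "('i \<Rightarrow> 'a) \<Rightarrow> 'i set \<Rightarrow> 'a emultiset" where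
  "family_emset f I = (\<lambda>x. ecard {i \<in> I. f i = x})"

definition emset_union :: "'a emultiset \<Rightarrow> 'a emultiset \<Rightarrow> 'a emultiset" where
  "emset_union M N = (\<lambda>x. M x + N x)"

text \<open>The point spectrum, as a multiset, of an operator \<open>T\<close> on a closed subspace \<open>M\<close>.\<close>

definition point_spectrum :: "'a::complex_hilbert set \<Rightarrow> ('a \<Rightarrow> 'a) \<Rightarrow> complex emultiset" where
  "point_spectrum M T = (\<lambda>\<mu>. cdimension {x \<in> M. T x = scaleC \<mu> x})"


section \<open>The Hardy space of the unit disc\<close>

text \<open>
  Elements are extended by 0 outside the disc, so that they are determined by their
  values on the disc.
\<close>

typedef hardy =
  "{f :: complex \<Rightarrow> complex. f holomorphic_on ball 0 1 \<and>
      summable (\<lambda>n. (cmod (fps_nth (fps_expansion f 0) n))\<^sup>2) \<and>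
      (\<forall>z. z \<notin> ball 0 1 \<longrightarrow> f z = 0)}"
proof -
  have "fps_expansion (\<lambda>z. 0) 0 = (0 :: complex fps)"
    by (rule fps_expansion_eqI) simp
  thus ?thesis by (intro exI[of _ "\<lambda>z. 0"]) simp
qed

definition hardy_coeff :: "hardy \<Rightarrow> nat \<Rightarrow> complex" where
  "hardy_coeff f n = fps_nth (fps_expansion (Rep_hardy f) 0) n"

definition hardy_monom :: "nat \<Rightarrow> hardy" where
  "hardy_monom k = Abs_hardy (\<lambda>z. if z \<in> ball 0 1 then z ^ k else 0)"

definition hardy_of_coeffs :: "(nat \<Rightarrow> complex) \<Rightarrow> hardy" where
  "hardy_of_coeffs a = Abs_hardy (\<lambda>z. if z \<in> ball 0 1 then (\<Sum>n. a n * z ^ n) else 0)"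

lemma hardy_has_fps: "Rep_hardy f has_fps_expansion fps_expansion (Rep_hardy f) 0"
  using Rep_hardy[of f] by (intro has_fps_expansion_fps_expansion[of "ball 0 1"]) auto

lemma hardy_summable: "summable (\<lambda>n. (cmod (hardy_coeff f n))\<^sup>2)"
  using Rep_hardy[of f] by (simp add: hardy_coeff_def)

lemma hardy_sums:
  assumes "norm z < 1"
  shows "(\<lambda>n. hardy_coeff f n * z ^ n) sums Rep_hardy f z"
  unfolding hardy_coeff_def
  by (rule has_fps_expansion_imp_sums_complex[where r = 1, OF hardy_has_fps])
     (use Rep_hardy[of f] assms in \<open>auto simp: one_ereal_def\<close>)

lemma hardy_eqI:
  assumes "\<And>n. hardy_coeff f n = hardy_coeff g n"
  shows "f = g"
proof -
  have "Rep_hardy f z = Rep_hardy g z" for z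
  proof (cases "norm z < 1")
    case True
    from hardy_sums[OF True, of f] hardy_sums[OF True, of g] show ?thesis
      by (simp add: assms sums_unique2)
  next
    case False
    thus ?thesis using Rep_hardy[of f] Rep_hardy[of g] by simp
  qed
  thus ?thesis by (metis Rep_hardy_inject ext)
qed

lemma square_summable_mult:
  fixes a b :: "nat \<Rightarrow> complex"
  assumes "summable (\<lambda>n. (cmod (a n))\<^sup>2)" "summable (\<lambda>n. (cmod (b n))\<^sup>2)"
  shows "summable (\<lambda>n. cmod (a n * b n))"
proof (rule summable_comparison_test'[where N = 0])
  show "summable (\<lambda>n. (cmod (a n))\<^sup>2 + (cmod (b n))\<^sup>2)"
    using assms by (rule summable_add)
  fix n
  have "0 \<le> (cmod (a n) - cmod (b n))\<^sup>2" by simp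
  hence "2 * (cmod (a n) * cmod (b n)) \<le> (cmod (a n))\<^sup>2 + (cmod (b n))\<^sup>2"
    by (simp add: power2_diff)
  moreover have "0 \<le> cmod (a n) * cmod (b n)" by simp
  ultimately have "cmod (a n) * cmod (b n) \<le> (cmod (a n))\<^sup>2 + (cmod (b n))\<^sup>2"
    by linarith
  thus "norm (cmod (a n * b n)) \<le> (cmod (a n))\<^sup>2 + (cmod (b n))\<^sup>2"
    by (simp add: norm_mult)
qed

lemma square_summable_add:
  fixes a b :: "nat \<Rightarrow> complex"
  assumes "summable (\<lambda>n. (cmod (a n))\<^sup>2)" "summable (\<lambda>n. (cmod (b n))\<^sup>2)"
  shows "summable (\<lambda>n. (cmod (a n + b n))\<^sup>2)"
proof (rule summable_comparison_test'[where N = 0])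
  show "summable (\<lambda>n. 2 * (cmod (a n))\<^sup>2 + 2 * (cmod (b n))\<^sup>2)"
    using assms by (intro summable_add summable_mult)
  fix n
  have "(cmod (a n + b n))\<^sup>2 \<le> (cmod (a n) + cmod (b n))\<^sup>2"
    by (intro power_mono norm_triangle_ineq) simp
  also have "\<dots> \<le> 2 * (cmod (a n))\<^sup>2 + 2 * (cmod (b n))\<^sup>2"
    using zero_le_power2[of "cmod (a n) - cmod (b n)"]
    by (simp add: power2_sum power2_diff)
  finally show "norm ((cmod (a n + b n))\<^sup>2) \<le> 2 * (cmod (a n))\<^sup>2 + 2 * (cmod (b n))\<^sup>2"
    by simp
qed

lemma square_summable_cmult:
  fixes a :: "nat \<Rightarrow> complex"
  assumes "summable (\<lambda>n. (cmod (a n))\<^sup>2)"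
  shows "summable (\<lambda>n. (cmod (c * a n))\<^sup>2)"
  using summable_mult[OF assms, of "(cmod c)\<^sup>2"] by (simp add: norm_mult power_mult_distrib)

lemma square_summable_radius:
  fixes a :: "nat \<Rightarrow> complex"
  assumes "summable (\<lambda>n. (cmod (a n))\<^sup>2)"
  shows "fps_conv_radius (Abs_fps a) \<ge> 1"
  unfolding fps_conv_radius_def
proof (rule conv_radius_geI_ex')
  fix r :: real assume "0 < r" "ereal r < 1"
  hence r: "0 < r" "r < 1" by (auto simp: one_ereal_def)
  have "r\<^sup>2 < 1" using r by (simp add: power_less_one_iff)
  hence "summable (\<lambda>n. (r\<^sup>2) ^ n)" by (intro summable_geometric) simp
  hence "summable (\<lambda>n. (cmod (of_real r ^ n))\<^sup>2)"
    using r by (simp add: norm_power mult.commute flip: power_mult)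
  from summable_norm_cancel[OF square_summable_mult[OF assms this]]
  show "summable (\<lambda>n. fps_nth (Abs_fps a) n * of_real r ^ n)" by simp
qed

lemma
  assumes "summable (\<lambda>n. (cmod (a n))\<^sup>2)"
  shows Rep_hardy_of_coeffs: "Rep_hardy (hardy_of_coeffs a) =
      (\<lambda>z. if z \<in> ball 0 1 then (\<Sum>n. a n * z ^ n) else 0)" (is "_ = ?f")
    and hardy_coeff_of_coeffs: "hardy_coeff (hardy_of_coeffs a) = a"
proof -
  let ?F = "Abs_fps a"
  have R: "fps_conv_radius ?F \<ge> 1" by (rule square_summable_radius[OF assms])
  have ev: "?f z = eval_fps ?F z" if "z \<in> ball 0 1" for z
    using that by (simp add: eval_fps_def)
  have "eval_fps ?F holomorphic_on ball 0 1"
    by (rule holomorphic_on_eval_fps)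
       (metis R ball_eball_mono one_ereal_def eball_ereal order_trans subsetI subsetD eball_mono)
  hence hol: "?f holomorphic_on ball 0 1"
    by (subst holomorphic_cong[OF refl ev]) auto
  have "?f has_fps_expansion ?F"
    unfolding has_fps_expansion_def
  proof
    show "fps_conv_radius ?F > 0"
      using R by (rule less_le_trans[rotated]) simp
    have "eventually (\<lambda>z::complex. z \<in> ball 0 1) (nhds 0)"
      by (intro eventually_nhds_in_open) auto
    thus "eventually (\<lambda>z. eval_fps ?F z = ?f z) (nhds 0)"
      by eventually_elim (use ev in simp)
  qed
  hence F: "fps_expansion ?f 0 = ?F" by (rule fps_expansion_eqI)
  show *: "Rep_hardy (hardy_of_coeffs a) = ?f"
    unfolding hardy_of_coeffs_def
    by (rule Abs_hardy_inverse) (use hol F assms in simp)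
  show "hardy_coeff (hardy_of_coeffs a) = a"
    using F by (auto simp: hardy_coeff_def *)
qed

instantiation hardy :: ab_group_add
begin

definition zero_hardy :: hardy where
  "0 = Abs_hardy (\<lambda>z. 0)"

definition plus_hardy :: "hardy \<Rightarrow> hardy \<Rightarrow> hardy" where
  "f + g = Abs_hardy (\<lambda>z. Rep_hardy f z + Rep_hardy g z)"

definition uminus_hardy :: "hardy \<Rightarrow> hardy" where
  "- f = Abs_hardy (\<lambda>z. - Rep_hardy f z)"

definition minus_hardy :: "hardy \<Rightarrow> hardy \<Rightarrow> hardy" where
  "f - g = Abs_hardy (\<lambda>z. Rep_hardy f z - Rep_hardy g z)"

lemma hardy_expansion_add:
  "fps_expansion (\<lambda>z. Rep_hardy f z + Rep_hardy g z) 0 =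
     fps_expansion (Rep_hardy f) 0 + fps_expansion (Rep_hardy g) 0"
  by (intro fps_expansion_eqI has_fps_expansion_add hardy_has_fps)

lemma hardy_expansion_cmult:
  "fps_expansion (\<lambda>z. c * Rep_hardy f z) 0 = fps_const c * fps_expansion (Rep_hardy f) 0"
  by (intro fps_expansion_eqI has_fps_expansion_cmult_left hardy_has_fps)

lemma Rep_hardy_add: "Rep_hardy (f + g) = (\<lambda>z. Rep_hardy f z + Rep_hardy g z)"
  unfolding plus_hardy_def
proof (rule Abs_hardy_inverse, intro CollectI conjI)
  show "summable (\<lambda>n. (cmod (fps_nth (fps_expansion (\<lambda>z. Rep_hardy f z + Rep_hardy g z) 0) n))\<^sup>2)"
    using square_summable_add[OF hardy_summable[of f] hardy_summable[of g]]
    by (simp add: hardy_expansion_add hardy_coeff_def)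
qed (use Rep_hardy[of f] Rep_hardy[of g] in \<open>auto intro: holomorphic_intros\<close>)

lemma Abs_hardy_cmult_inverse:
  "Rep_hardy (Abs_hardy (\<lambda>z. c * Rep_hardy f z)) = (\<lambda>z. c * Rep_hardy f z)"
proof (rule Abs_hardy_inverse, intro CollectI conjI)
  show "summable (\<lambda>n. (cmod (fps_nth (fps_expansion (\<lambda>z. c * Rep_hardy f z) 0) n))\<^sup>2)"
    using square_summable_cmult[OF hardy_summable[of f], of c]
    by (simp add: hardy_expansion_cmult hardy_coeff_def)
qed (use Rep_hardy[of f] in \<open>auto intro: holomorphic_intros\<close>)

lemma Rep_hardy_uminus: "Rep_hardy (- f) = (\<lambda>z. - Rep_hardy f z)"
  using Abs_hardy_cmult_inverse[of "-1" f] by (simp add: uminus_hardy_def)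

lemma Rep_hardy_zero: "Rep_hardy 0 = (\<lambda>z. 0)"
  using Abs_hardy_cmult_inverse[of 0] by (simp add: zero_hardy_def)

lemma Rep_hardy_minus: "Rep_hardy (f - g) = (\<lambda>z. Rep_hardy f z - Rep_hardy g z)"
  using Rep_hardy_add[of f "- g"]
  by (simp add: plus_hardy_def minus_hardy_def Rep_hardy_uminus)

instance
proof
  fix f g h :: hardy
  show "f + g + h = f + (g + h)" "f + g = g + f" "0 + f = f" "- f + f = 0" "f - g = f + - g"
    by (simp_all flip: Rep_hardy_inject
        add: Rep_hardy_add Rep_hardy_uminus Rep_hardy_zero Rep_hardy_minus algebra_simps)
qed

end

text \<open>
  The norm and the inner product are those of the sequence of Taylor coefficients, so the
  functions \<open>hardy_monom k\<close> form an orthonormal basis.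
\<close>

lemma hardy_coeff_add: "hardy_coeff (f + g) n = hardy_coeff f n + hardy_coeff g n"
  by (simp add: hardy_coeff_def Rep_hardy_add hardy_expansion_add)

lemma hardy_coeff_cmult: "hardy_coeff (Abs_hardy (\<lambda>z. c * Rep_hardy f z)) n = c * hardy_coeff f n"
  by (simp add: hardy_coeff_def Abs_hardy_cmult_inverse hardy_expansion_cmult)

lemma hardy_coeff_zero: "hardy_coeff 0 n = 0"
  using hardy_coeff_add[of 0 0 n] by simp

lemma hardy_coeff_diff: "hardy_coeff (f - g) n = hardy_coeff f n - hardy_coeff g n"
  using hardy_coeff_add[of "f - g" g n] by simp

instantiation hardy :: real_normed_vector
begin

definition scaleR_hardy :: "real \<Rightarrow> hardy \<Rightarrow> hardy" where
  "scaleR r f = Abs_hardy (\<lambda>z. complex_of_real r * Rep_hardy f z)"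

definition norm_hardy :: "hardy \<Rightarrow> real" where
  "norm f = sqrt (\<Sum>n. (cmod (hardy_coeff f n))\<^sup>2)"

definition dist_hardy :: "hardy \<Rightarrow> hardy \<Rightarrow> real" where
  "dist f g = norm (f - g :: hardy)"

definition sgn_hardy :: "hardy \<Rightarrow> hardy" where
  "sgn f = scaleR (inverse (norm f)) (f :: hardy)"

definition uniformity_hardy :: "(hardy \<times> hardy) filter" where
  "uniformity_hardy = (INF e\<in>{0 <..}. principal {(x, y). dist (x::hardy) y < e})"

definition open_hardy :: "hardy set \<Rightarrow> bool" where
  "open_hardy U \<longleftrightarrow> (\<forall>x\<in>U. eventually (\<lambda>(x', y). x' = x \<longrightarrow> y \<in> U) uniformity)"

lemma hardy_L2_le_norm: "L2_set (\<lambda>n. cmod (hardy_coeff f n)) {..<k} \<le> norm f"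
  unfolding norm_hardy_def L2_set_def
  by (intro real_sqrt_le_mono sum_le_suminf hardy_summable) auto

lemma hardy_norm_le:
  assumes "\<And>k. L2_set (\<lambda>n. cmod (hardy_coeff f n)) {..<k} \<le> C"
  shows "norm f \<le> C"
proof -
  have "0 \<le> C" using assms[of 0] by simp
  have "(\<Sum>n<k. (cmod (hardy_coeff f n))\<^sup>2) \<le> C\<^sup>2" for k
    using power_mono[OF assms[of k], of 2] by (simp add: L2_set_def sum_nonneg)
  hence "(\<Sum>n. (cmod (hardy_coeff f n))\<^sup>2) \<le> C\<^sup>2"
    by (intro suminf_le_const hardy_summable)
  thus ?thesis unfolding norm_hardy_def by (intro real_le_lsqrt) (use \<open>0 \<le> C\<close> in auto)
qed

lemma hardy_coeff_le_norm: "cmod (hardy_coeff f n) \<le> norm f"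
proof -
  have "cmod (hardy_coeff f n) \<le> L2_set (\<lambda>n. cmod (hardy_coeff f n)) {..<Suc n}"
    by (rule member_le_L2_set) auto
  thus ?thesis using hardy_L2_le_norm[of f "Suc n"] by linarith
qed

instance
proof
  fix f g h :: hardy and r s :: real
  show "dist f g = norm (f - g)" by (rule dist_hardy_def)
  show "sgn f = scaleR (inverse (norm f)) f" by (rule sgn_hardy_def)
  show "uniformity = (INF e\<in>{0 <..}. principal {(x, y). dist (x::hardy) y < e})"
    by (rule uniformity_hardy_def)
  show "open U \<longleftrightarrow> (\<forall>x\<in>U. eventually (\<lambda>(x', y). x' = x \<longrightarrow> y \<in> U) uniformity)" for U :: "hardy set"
    by (rule open_hardy_def)
  show "scaleR r (f + g) = scaleR r f + scaleR r g" "scaleR (r + s) f = scaleR r f + scaleR s f"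
       "scaleR r (scaleR s f) = scaleR (r * s) f" "scaleR 1 f = f"
    by (rule hardy_eqI; simp only: scaleR_hardy_def hardy_coeff_add hardy_coeff_cmult;
        simp add: algebra_simps)+
  show "norm f = 0 \<longleftrightarrow> f = 0"
  proof
    assume "norm f = 0"
    with hardy_coeff_le_norm[of f] show "f = 0"
      by (intro hardy_eqI) (simp add: hardy_coeff_zero)
  qed (simp add: norm_hardy_def hardy_coeff_zero)
  show "norm (f + g) \<le> norm f + norm g"
  proof (rule hardy_norm_le)
    fix k
    have "L2_set (\<lambda>n. cmod (hardy_coeff (f + g) n)) {..<k}
            \<le> L2_set (\<lambda>n. cmod (hardy_coeff f n) + cmod (hardy_coeff g n)) {..<k}"
      by (rule L2_set_mono) (auto simp: hardy_coeff_add norm_triangle_ineq)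
    also have "\<dots> \<le> L2_set (\<lambda>n. cmod (hardy_coeff f n)) {..<k} + L2_set (\<lambda>n. cmod (hardy_coeff g n)) {..<k}"
      by (rule L2_set_triangle_ineq)
    also have "\<dots> \<le> norm f + norm g"
      by (intro add_mono hardy_L2_le_norm)
    finally show "L2_set (\<lambda>n. cmod (hardy_coeff (f + g) n)) {..<k} \<le> norm f + norm g" .
  qed
  show "norm (scaleR r f) = \<bar>r\<bar> * norm f"
    by (simp add: norm_hardy_def scaleR_hardy_def hardy_coeff_cmult norm_mult power_mult_distrib
        suminf_mult[OF hardy_summable] real_sqrt_mult)
qed

end

instance hardy :: banach
proof
  fix X :: "nat \<Rightarrow> hardy"
  assume X: "Cauchy X"
  have ev: "\<exists>N. \<forall>m\<ge>N. \<forall>n\<ge>N. norm (X m - X n) < e" if "e > 0" for e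
    using X that unfolding Cauchy_def dist_norm by blast
  have "Cauchy (\<lambda>m. hardy_coeff (X m) k)" for k
    unfolding Cauchy_def dist_complex_def
  proof (intro allI impI)
    fix e :: real assume "e > 0"
    from ev[OF this] obtain N where "\<forall>m\<ge>N. \<forall>n\<ge>N. norm (X m - X n) < e" by blast
    hence "cmod (hardy_coeff (X m) k - hardy_coeff (X n) k) < e" if "m \<ge> N" "n \<ge> N" for m n
      using hardy_coeff_le_norm[of "X m - X n" k] that
      by (simp add: hardy_coeff_diff) (meson le_less_trans)
    thus "\<exists>M. \<forall>m\<ge>M. \<forall>n\<ge>M. cmod (hardy_coeff (X m) k - hardy_coeff (X n) k) < e"
      by blast
  qed
  hence "\<forall>k. \<exists>l. (\<lambda>m. hardy_coeff (X m) k) \<longlonglongrightarrow> l"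
    using Cauchy_convergent unfolding convergent_def by blast
  then obtain a where a: "\<And>k. (\<lambda>m. hardy_coeff (X m) k) \<longlonglongrightarrow> a k" by metis
  have bd: "L2_set (\<lambda>k. cmod (a k - hardy_coeff (X n) k)) {..<K} \<le> e"
    if N: "\<forall>m\<ge>N. \<forall>n\<ge>N. norm (X m - X n) < e" and "n \<ge> N" for N n K e
  proof (rule tendsto_upperbound)
    show "(\<lambda>m. L2_set (\<lambda>k. cmod (hardy_coeff (X m) k - hardy_coeff (X n) k)) {..<K})
            \<longlonglongrightarrow> L2_set (\<lambda>k. cmod (a k - hardy_coeff (X n) k)) {..<K}"
      unfolding L2_set_def by (intro tendsto_intros a)
    show "\<forall>\<^sub>F m in sequentially.
            L2_set (\<lambda>k. cmod (hardy_coeff (X m) k - hardy_coeff (X n) k)) {..<K} \<le> e"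
      using eventually_ge_at_top[of N]
    proof eventually_elim
      case (elim m)
      have "L2_set (\<lambda>k. cmod (hardy_coeff (X m - X n) k)) {..<K} \<le> norm (X m - X n)"
        by (rule hardy_L2_le_norm)
      also have "\<dots> \<le> e" using N elim \<open>n \<ge> N\<close> by (simp add: less_imp_le)
      finally show ?case by (simp add: hardy_coeff_diff)
    qed
  qed simp
  have diff: "summable (\<lambda>k. (cmod (a k - hardy_coeff (X n) k))\<^sup>2)"
    if N: "\<forall>m\<ge>N. \<forall>n\<ge>N. norm (X m - X n) < e" and "n \<ge> N" for N n e
  proof (rule summableI_nonneg_bounded)
    fix K
    show "(\<Sum>k<K. (cmod (a k - hardy_coeff (X n) k))\<^sup>2) \<le> e\<^sup>2"
      using power_mono[OF bd[OF that, of K], of 2] by (simp add: L2_set_def sum_nonneg)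
  qed simp
  obtain N where "\<forall>m\<ge>N. \<forall>n\<ge>N. norm (X m - X n) < 1" using ev[of 1] by auto
  from square_summable_add[OF diff[OF this order_refl] hardy_summable[of "X N"]]
  have "summable (\<lambda>k. (cmod (a k))\<^sup>2)" by simp
  hence L: "hardy_coeff (hardy_of_coeffs a) = a" by (rule hardy_coeff_of_coeffs)
  have "X \<longlonglongrightarrow> hardy_of_coeffs a"
    unfolding LIMSEQ_iff
  proof (intro allI impI)
    fix e :: real assume e: "e > 0"
    then obtain N where N: "\<forall>m\<ge>N. \<forall>n\<ge>N. norm (X m - X n) < e/2" using ev[of "e/2"] by auto
    have "norm (X n - hardy_of_coeffs a) < e" if "n \<ge> N" for n
    proof -
      have "norm (hardy_of_coeffs a - X n) \<le> e/2"
        by (rule hardy_norm_le) (use bd[OF N that] in \<open>simp add: hardy_coeff_diff L\<close>)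
      thus ?thesis using e by (simp add: norm_minus_commute)
    qed
    thus "\<exists>no. \<forall>n\<ge>no. norm (X n - hardy_of_coeffs a) < e" by blast
  qed
  thus "convergent X" unfolding convergent_def by blast
qed

instantiation hardy :: complex_hilbert
begin

definition scaleC_hardy :: "complex \<Rightarrow> hardy \<Rightarrow> hardy" where
  "scaleC c f = Abs_hardy (\<lambda>z. c * Rep_hardy f z)"

definition cinner_hardy :: "hardy \<Rightarrow> hardy \<Rightarrow> complex" where
  "cinner f g = (\<Sum>n. hardy_coeff f n * cnj (hardy_coeff g n))"

lemma hardy_coeff_scaleC: "hardy_coeff (scaleC c f) n = c * hardy_coeff f n"
  by (simp add: scaleC_hardy_def hardy_coeff_cmult)

lemma hardy_cinner_summable: "summable (\<lambda>n. hardy_coeff f n * cnj (hardy_coeff g n))"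
  by (rule summable_norm_cancel, rule square_summable_mult)
     (use hardy_summable[of f] hardy_summable[of g] in simp_all)

instance
proof
  fix f g h :: hardy and r :: real and c d :: complex
  show "scaleC c (f + g) = scaleC c f + scaleC c g" "scaleC (c + d) f = scaleC c f + scaleC d f"
       "scaleC c (scaleC d f) = scaleC (c * d) f" "scaleC 1 f = f"
    by (rule hardy_eqI; simp add: hardy_coeff_add hardy_coeff_scaleC algebra_simps)+
  show "scaleR r f = scaleC (complex_of_real r) f" by (simp add: scaleR_hardy_def scaleC_hardy_def)
  have "0 \<le> (\<Sum>n. (cmod (hardy_coeff f n))\<^sup>2)"
    by (intro suminf_nonneg hardy_summable) auto
  thus "cinner f f = complex_of_real ((norm f)\<^sup>2)"
    by (simp add: cinner_hardy_def norm_hardy_def complex_norm_square[symmetric]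
        suminf_of_real[OF hardy_summable] del: of_real_power)
  have "(\<lambda>n. cnj (hardy_coeff g n * cnj (hardy_coeff f n))) sums cnj (cinner g f)"
    unfolding sums_cnj cinner_hardy_def
    by (rule summable_sums[OF hardy_cinner_summable])
  thus "cinner f g = cnj (cinner g f)" by (simp add: cinner_hardy_def sums_iff mult.commute)
  show "cinner (f + g) h = cinner f h + cinner g h"
    by (simp add: cinner_hardy_def hardy_coeff_add algebra_simps
        suminf_add[OF hardy_cinner_summable hardy_cinner_summable])
  show "cinner (scaleC c f) g = c * cinner f g"
    by (simp add: cinner_hardy_def hardy_coeff_scaleC mult.assoc
        suminf_mult[OF hardy_cinner_summable])
qed

end

definition weighted_shift :: "(nat \<Rightarrow> real) \<Rightarrow> hardy \<Rightarrow> hardy" where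
  "weighted_shift w = (THE S. bounded_clinear S \<and>
     (\<forall>i. S (hardy_monom i) = scaleC (complex_of_real (w i)) (hardy_monom (Suc i))))"

text \<open>
  The Hilbert space tensor product of the Hardy space with itself exists; it can be
  modelled on the Hardy space again by reindexing the orthonormal basis.
\<close>

lemma hardy_monom_conv: "hardy_monom k = hardy_of_coeffs (\<lambda>n. if n = k then 1 else 0)"
proof -
  have "(\<Sum>n. (if n = k then 1 else 0) * z ^ n) = z ^ k" for z :: complex
    using suminf_finite[of "{k}" "\<lambda>n. (if n = k then 1 else 0) * z ^ n"] by simp
  hence "(\<lambda>z::complex. if z \<in> ball 0 1 then z ^ k else 0) =
      (\<lambda>z. if z \<in> ball 0 1 then (\<Sum>n. (if n = k then 1 else 0) * z ^ n) else 0)"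
    by presburger
  thus ?thesis unfolding hardy_monom_def hardy_of_coeffs_def by (rule arg_cong)
qed

lemma hardy_coeff_monom: "hardy_coeff (hardy_monom k) n = (if n = k then 1 else 0)"
proof -
  have "summable (\<lambda>n. (cmod (if n = k then 1 else 0))\<^sup>2)"
    by (rule summable_finite[of "{k}"]) auto
  thus ?thesis by (simp add: hardy_monom_conv hardy_coeff_of_coeffs)
qed

lemma hardy_coeff_sum: "hardy_coeff (sum F A) n = (\<Sum>i\<in>A. hardy_coeff (F i) n)"
  by (induction A rule: infinite_finite_induct) (simp_all add: hardy_coeff_zero hardy_coeff_add)

lemma hardy_expansion: "(\<lambda>n. scaleC (hardy_coeff f n) (hardy_monom n)) sums f"
  unfolding sums_def
proof (rule LIMSEQ_I)
  fix e :: real assume "e > 0"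
  have c: "hardy_coeff ((\<Sum>i<m. scaleC (hardy_coeff f i) (hardy_monom i)) - f) n =
          (if n < m then 0 else - hardy_coeff f n)" for m n
    by (simp add: hardy_coeff_diff hardy_coeff_sum hardy_coeff_scaleC hardy_coeff_monom
        if_distrib cong: if_cong)
  have "(\<lambda>m. \<Sum>n. (cmod (hardy_coeff f (n + m)))\<^sup>2) \<longlonglongrightarrow> 0"
    by (rule suminf_exist_split2[OF hardy_summable])
  moreover have "(norm ((\<Sum>i<m. scaleC (hardy_coeff f i) (hardy_monom i)) - f))\<^sup>2 =
          (\<Sum>n. (cmod (hardy_coeff f (n + m)))\<^sup>2)" (is "(norm ?g)\<^sup>2 = _") for m
  proof -
    have "(norm ?g)\<^sup>2 = (\<Sum>n. (cmod (hardy_coeff ?g n))\<^sup>2)"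
      unfolding norm_hardy_def by (intro real_sqrt_pow2 suminf_nonneg hardy_summable) auto
    also have "\<dots> = (\<Sum>n. (cmod (hardy_coeff ?g (n + m)))\<^sup>2)"
      by (subst suminf_split_initial_segment[OF hardy_summable, of _ m]) (simp add: c)
    finally show ?thesis by (simp add: c)
  qed
  ultimately have "(\<lambda>m. (norm ((\<Sum>i<m. scaleC (hardy_coeff f i) (hardy_monom i)) - f))\<^sup>2) \<longlonglongrightarrow> 0"
    by simp
  from tendsto_real_sqrt[OF this]
  have "(\<lambda>m. norm ((\<Sum>i<m. scaleC (hardy_coeff f i) (hardy_monom i)) - f)) \<longlonglongrightarrow> 0" by simp
  from LIMSEQ_D[OF this \<open>e > 0\<close>]
  show "\<exists>no. \<forall>n\<ge>no. norm ((\<Sum>i<n. scaleC (hardy_coeff f i) (hardy_monom i)) - f) < e" by simp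
qed

lemma prod_decode_sums:
  fixes a b :: "nat \<Rightarrow> complex"
  assumes "summable (\<lambda>n. cmod (a n))" "summable (\<lambda>n. cmod (b n))"
  shows "summable (\<lambda>k. cmod (case prod_decode k of (m, n) \<Rightarrow> a m * b n))"
    and "(\<lambda>k. case prod_decode k of (m, n) \<Rightarrow> a m * b n) sums ((\<Sum>n. a n) * (\<Sum>n. b n))"
proof -
  let ?f = "\<lambda>(m, n). a m * b n"
  have ab: "Infinite_Set_Sum.abs_summable_on a UNIV" "Infinite_Set_Sum.abs_summable_on b UNIV"
    using assms by (simp_all add: abs_summable_on_nat_iff')
  have "Infinite_Set_Sum.abs_summable_on ?f (UNIV \<times> UNIV)"
    by (rule abs_summable_on_product) (use ab in auto)
  hence s: "Infinite_Set_Sum.abs_summable_on (\<lambda>k. ?f (prod_decode k)) UNIV"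
    by (subst abs_summable_on_reindex_bij_betw[OF bij_prod_decode]) simp
  thus "summable (\<lambda>k. cmod (?f (prod_decode k)))"
    by (simp add: abs_summable_on_nat_iff')
  have "infsetsum (\<lambda>k. ?f (prod_decode k)) UNIV = infsetsum ?f (UNIV \<times> UNIV)"
    by (subst infsetsum_reindex_bij_betw[OF bij_prod_decode]) simp
  also have "\<dots> = infsetsum a UNIV * infsetsum b UNIV"
    by (rule infsetsum_product) (use ab in auto)
  also have "\<dots> = (\<Sum>n. a n) * (\<Sum>n. b n)"
    using ab by (simp add: infsetsum_nat')
  finally show "(\<lambda>k. ?f (prod_decode k)) sums ((\<Sum>n. a n) * (\<Sum>n. b n))"
    using sums_infsetsum_nat'[OF s] by simp
qed

lemma hilbert_tensor_hardy_exists: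
  "\<exists>tns :: hardy \<Rightarrow> hardy \<Rightarrow> hardy. hilbert_tensor tns"
proof -
  define p where "p f g = (\<lambda>k. case prod_decode k of (m, n) \<Rightarrow> hardy_coeff f m * hardy_coeff g n)" for f g
  define tns where "tns f g = hardy_of_coeffs (p f g)" for f g
  have abs2: "summable (\<lambda>n. cmod (hardy_coeff f n * cnj (hardy_coeff g n)))" for f g
    using square_summable_mult[OF hardy_summable[of f], of "\<lambda>n. cnj (hardy_coeff g n)"]
          hardy_summable[of g] by simp
  have "summable (\<lambda>k. (cmod (p f g k))\<^sup>2)" for f g
  proof -
    have "cmod (case prod_decode k of (m, n) \<Rightarrow> (hardy_coeff f m * cnj (hardy_coeff f m)) *
            (hardy_coeff g n * cnj (hardy_coeff g n))) = (cmod (p f g k))\<^sup>2" for k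
      by (auto simp: p_def norm_mult power2_eq_square split: prod.splits)
    with prod_decode_sums(1)[OF abs2[of f f] abs2[of g g]] show ?thesis by simp
  qed
  hence c: "hardy_coeff (tns f g) = p f g" for f g
    by (simp add: tns_def hardy_coeff_of_coeffs)
  have inner: "cinner (tns f g) (tns f' g') = cinner f f' * cinner g g'" for f g f' g'
  proof -
    have "(case prod_decode k of (m, n) \<Rightarrow> (hardy_coeff f m * cnj (hardy_coeff f' m)) *
            (hardy_coeff g n * cnj (hardy_coeff g' n))) = p f g k * cnj (p f' g' k)" for k
      by (auto simp: p_def split: prod.splits)
    with prod_decode_sums(2)[OF abs2[of f f'] abs2[of g g']] show ?thesis
      by (simp add: cinner_hardy_def c sums_iff)
  qed
  let ?S = "cvec.span {tns u v | u v. True}"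
  have monom: "hardy_monom k \<in> ?S" for k
  proof -
    have "hardy_monom k = tns (hardy_monom (fst (prod_decode k))) (hardy_monom (snd (prod_decode k)))"
    proof (rule hardy_eqI)
      fix n
      have "n = k \<longleftrightarrow> fst (prod_decode n) = fst (prod_decode k) \<and> snd (prod_decode n) = snd (prod_decode k)"
        by (metis prod_decode_inverse prod_eq_iff)
      thus "hardy_coeff (hardy_monom k) n =
          hardy_coeff (tns (hardy_monom (fst (prod_decode k))) (hardy_monom (snd (prod_decode k)))) n"
        by (simp add: c p_def hardy_coeff_monom case_prod_unfold)
    qed
    thus ?thesis by (auto intro!: cvec.span_base)
  qed
  have "f \<in> closure ?S" for f
  proof -
    have "(\<Sum>i<m. scaleC (hardy_coeff f i) (hardy_monom i)) \<in> ?S" for m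
      by (intro cvec.span_sum cvec.span_scale monom)
    thus ?thesis
      using hardy_expansion[of f] unfolding closure_sequential sums_def
      by (intro exI[of _ "\<lambda>m. \<Sum>i<m. scaleC (hardy_coeff f i) (hardy_monom i)"]) blast
  qed
  hence dense: "closure ?S = UNIV" by blast
  have "hilbert_tensor tns"
    unfolding hilbert_tensor_def
    by (intro conjI allI inner dense; rule hardy_eqI)
       (auto simp: c p_def hardy_coeff_add hardy_coeff_scaleC algebra_simps split: prod.splits)
  thus ?thesis by blast
qed


section \<open>The polynomials\<close>

text \<open>
  Only \<open>D_poly w n m\<close> and \<open>K_poly w n m\<close> with \<open>m \<le> n\<close> are used; in this range, and for
  \<open>n \<ge> 1\<close>, no subtraction on natural numbers below is truncated.
\<close>

fun D_poly :: "(nat \<Rightarrow> real) \<Rightarrow> nat \<Rightarrow> nat \<Rightarrow> complex poly" where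
  "D_poly w n 0 = 1"
| "D_poly w n (Suc 0) = [:0, 1:]"
| "D_poly w n (Suc (Suc m)) = [:0, 1:] * D_poly w n (Suc m)
     - smult (complex_of_real (1/4 * (w m)\<^sup>2 * (w (2 * n - (m + 2)))\<^sup>2)) (D_poly w n m)"

fun K_poly :: "(nat \<Rightarrow> real) \<Rightarrow> nat \<Rightarrow> nat \<Rightarrow> complex poly" where
  "K_poly w n 0 = 1"
| "K_poly w n (Suc 0) = [:0, 1:]"
| "K_poly w n (Suc (Suc m)) = [:0, 1:] * K_poly w n (Suc m)
     - smult (complex_of_real (1/4 * (w m)\<^sup>2 * (w (2 * n - (m + 2) + 1))\<^sup>2)) (K_poly w n m)"

text \<open>
  \<open>C_poly s w n\<close> is $C^{+}_{2n}$ for \<open>s = 1\<close> and $C^{-}_{2n}$ for \<open>s = -1\<close>.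
\<close>

definition C_poly :: "real \<Rightarrow> (nat \<Rightarrow> real) \<Rightarrow> nat \<Rightarrow> complex poly" where
  "C_poly s w n =
     [:- complex_of_real (s * (1/2) * (w (n - 1))\<^sup>2), 1:] * D_poly w n (n - 1)
     - (if n = 1 then 0
        else smult (complex_of_real (1/4 * (w (n - 2))\<^sup>2 * (w n)\<^sup>2)) (D_poly w n (n - 2)))"

abbreviation C_plus :: "(nat \<Rightarrow> real) \<Rightarrow> nat \<Rightarrow> complex poly" where
  "C_plus \<equiv> C_poly 1"

abbreviation C_minus :: "(nat \<Rightarrow> real) \<Rightarrow> nat \<Rightarrow> complex poly" where
  "C_minus \<equiv> C_poly (- 1)"

definition G_plus :: "(nat \<Rightarrow> real) \<Rightarrow> nat \<Rightarrow> complex poly" where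
  "G_plus w n = [:0, 1:] * K_poly w n n
     - smult (complex_of_real (1/2 * (w (n - 1))\<^sup>2 * (w n)\<^sup>2)) (K_poly w n (n - 1))"

definition G_minus :: "(nat \<Rightarrow> real) \<Rightarrow> nat \<Rightarrow> complex poly" where
  "G_minus w n = K_poly w n n"

end

theory Submission
  imports Defs
begin

text \<open>
  The operator $\frac12(S_w \otimes S_w^* + S_w^* \otimes S_w)$ maps $z^i \otimes z^j$ into the span of
  $z^{i+1} \otimes z^{j-1}$ and $z^{i-1} \otimes z^{j+1}$, so it preserves every sector $i + j = N$.
  There it is a tridiagonal matrix that is invariant under the flip, and on the symmetric and the
  antisymmetric half it folds to the tridiagonal matrices with characteristic polynomials
  $C^{\pm}_{N+1}$ for odd and $G^{\pm}_{N+1}$ for even $N$. These matrices are symmetrizable, hence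
  geometric and algebraic multiplicities agree, and an eigenspace of the whole operator is the
  orthogonal sum of the eigenspaces in the sectors. The sector $N = 0$ is symmetric and yields the
  additional eigenvalue 0.
\<close>

section \<open>Hilbert spaces and orthonormal bases\<close>

text \<open>The tensor product is abstract and every operator is a definite description, so both are
  accessible only through coefficients. The shift, its adjoint, their tensor products and the flip
  all replace a coefficient by a multiple of the coefficient at another index. One existence theorem
  for such operators, combined with uniqueness, identifies each description. Weights may vanish, so
  the tridiagonal matrices can be reducible and can have multiple eigenvalues. They remain
  diagonalizable because nonnegative weights make the two entries that link neighbouring rows both
  zero or both positive. Infinitely many sectors may contribute to an eigenspace, whereas
  \<open>cdimension\<close> refers to algebraic spans. Identifying all infinite dimensions resolves
  this: if infinitely many sectors contribute, independence alone gives the value infinity;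
  otherwise every eigenvector is a finite sum of sector components.\<close>

lemma cinner_add_right: "cinner x (y + z) = cinner x y + cinner x (z::'a::complex_hilbert)"
  by (metis cinner_add_left cinner_commute complex_cnj_add)

lemma cinner_scaleC_right: "cinner x (scaleC c y) = cnj c * cinner x (y::'a::complex_hilbert)"
  by (metis cinner_scaleC_left cinner_commute complex_cnj_mult)

lemma cinner_zero_left [simp]: "cinner 0 (y::'a::complex_hilbert) = 0"
  using cinner_add_left[of 0 0 y] by simp

lemma cinner_zero_right [simp]: "cinner (y::'a::complex_hilbert) 0 = 0"
  using cinner_add_right[of y 0 0] by simp

lemma cinner_minus_left: "cinner (- x) (y::'a::complex_hilbert) = - cinner x y"
  using cinner_add_left[of x "- x" y] by (simp add: eq_neg_iff_add_eq_0 add.commute)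

lemma cinner_diff_left: "cinner (x - y) (z::'a::complex_hilbert) = cinner x z - cinner y z"
  using cinner_add_left[of x "- y" z] by (simp add: cinner_minus_left)

lemma cinner_diff_right: "cinner z (x - y) = cinner z x - cinner (z::'a::complex_hilbert) y"
  by (metis cinner_diff_left cinner_commute complex_cnj_diff)

lemma cinner_sum_left: "cinner (sum f A) (y::'a::complex_hilbert) = (\<Sum>i\<in>A. cinner (f i) y)"
  by (induction A rule: infinite_finite_induct) (simp_all add: cinner_add_left)

lemma cinner_sum_right: "cinner (y::'a::complex_hilbert) (sum f A) = (\<Sum>i\<in>A. cinner y (f i))"
  by (induction A rule: infinite_finite_induct) (simp_all add: cinner_add_right)

lemma cinner_self_eq_0 [simp]: "cinner x x = 0 \<longleftrightarrow> (x::'a::complex_hilbert) = 0"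
  by (simp add: cinner_norm)

lemma norm_scaleC: "norm (scaleC c (x::'a::complex_hilbert)) = cmod c * norm x"
proof -
  have "complex_of_real ((norm (scaleC c x))\<^sup>2) = c * cnj c * complex_of_real ((norm x)\<^sup>2)"
    by (simp only: cinner_norm[symmetric] cinner_scaleC_left cinner_scaleC_right) simp
  also have "\<dots> = complex_of_real ((cmod c * norm x)\<^sup>2)"
    by (simp add: complex_norm_square[symmetric] power_mult_distrib)
  finally have "(norm (scaleC c x))\<^sup>2 = (cmod c * norm x)\<^sup>2"
    by (simp only: of_real_eq_iff)
  thus ?thesis by simp
qed

lemma norm_add_square_orthogonal:
  assumes "cinner x y = 0"
  shows "(norm (x + y))\<^sup>2 = (norm x)\<^sup>2 + (norm (y::'a::complex_hilbert))\<^sup>2"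
proof -
  have "cinner y x = 0" using assms cinner_commute[of y x] by simp
  hence "cinner (x + y) (x + y) = cinner x x + cinner y y"
    using assms by (simp add: cinner_add_left cinner_add_right)
  hence "complex_of_real ((norm (x + y))\<^sup>2) = complex_of_real ((norm x)\<^sup>2 + (norm y)\<^sup>2)"
    by (simp only: cinner_norm of_real_add)
  thus ?thesis by (simp only: of_real_eq_iff)
qed

text \<open>Cauchy-Schwarz: by Pythagoras, the projection \<open>scaleC c y\<close> of
  \<open>x\<close> onto the line of \<open>y\<close> is no longer than \<open>x\<close>.\<close>

lemma cmod_cinner_le: "cmod (cinner x y) \<le> norm x * norm (y::'a::complex_hilbert)"
proof (cases "y = 0")
  case False
  define c where "c = cinner x y / cinner y y"
  have "cinner (x - scaleC c y) (scaleC c y) = 0"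
    using False by (simp add: cinner_scaleC_right cinner_diff_left cinner_scaleC_left c_def)
  from norm_add_square_orthogonal[OF this]
  have "norm (scaleC c y) \<le> norm x"
    by (simp add: power2_le_imp_le)
  moreover have "norm (scaleC c y) = cmod (cinner x y) / norm y"
    using False by (simp add: norm_scaleC c_def cinner_norm norm_divide norm_power norm_mult power2_eq_square)
  ultimately show ?thesis using False by (simp add: divide_le_eq)
qed simp

lemma bounded_linear_cinner_left: "bounded_linear (\<lambda>x. cinner x (y::'a::complex_hilbert))"
proof (rule bounded_linear_intro[where K = "norm y"])
  show "cinner (scaleR r x) y = scaleR r (cinner x y)" for r x
    by (simp add: scaleR_scaleC cinner_scaleC_left scaleR_conv_of_real)
qed (simp_all add: cinner_add_left cmod_cinner_le)

lemma bounded_clinearD: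
  assumes "bounded_clinear A"
  shows "bounded_linear A" "A (scaleC c x) = scaleC c (A x)" "A (x + y) = A x + A y" "A 0 = 0"
proof -
  have bl: "bounded_linear A" and sc: "A (scaleC c x) = scaleC c (A x)"
    using assms by (simp_all add: bounded_clinear_def)
  show "bounded_linear A" "A (scaleC c x) = scaleC c (A x)" by fact+
  show "A (x + y) = A x + A y" "A 0 = 0"
    using bounded_linear.linear[OF bl] by (simp_all only: linear_add linear_0)
qed

text \<open>Gives uniqueness in the definite descriptions of the shift, the tensor products of
  operators and the flip, each of which is prescribed on a set with dense span.\<close>

lemma bounded_clinear_eqI:
  assumes A: "bounded_clinear A" and B: "bounded_clinear B"
    and G: "closure (cvec.span G) = UNIV" and eq: "\<And>x. x \<in> G \<Longrightarrow> A x = B x"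
  shows "A = B"
proof
  fix x
  have s: "A x = B x" if "x \<in> cvec.span G" for x
    using that
  proof (induction rule: cvec.span_induct_alt)
    case (step c x y)
    thus ?case using eq[of x] by (simp only: bounded_clinearD(2,3)[OF A] bounded_clinearD(2,3)[OF B])
  qed (simp only: bounded_clinearD(4)[OF A] bounded_clinearD(4)[OF B])
  obtain X where X: "\<And>n. X n \<in> cvec.span G" "X \<longlonglongrightarrow> x"
  proof -
    have "x \<in> closure (cvec.span G)" using G by simp
    thus ?thesis using that unfolding closure_sequential by blast
  qed
  have "(\<lambda>n. A (X n)) \<longlonglongrightarrow> A x" "(\<lambda>n. B (X n)) \<longlonglongrightarrow> B x"
    using bounded_linear.tendsto[OF bounded_clinearD(1)[OF A] X(2)]
      bounded_linear.tendsto[OF bounded_clinearD(1)[OF B] X(2)] by blast+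
  thus "A x = B x" unfolding s[OF X(1)] by (rule LIMSEQ_unique)
qed

lemma orthogonal_to_dense_eq_0:
  assumes G: "closure (cvec.span G) = UNIV" and orth: "\<And>y. y \<in> G \<Longrightarrow> cinner x y = 0"
  shows "x = 0"
proof -
  have s: "cinner y x = 0" if "y \<in> cvec.span G" for y
    using that
  proof (induction rule: cvec.span_induct_alt)
    case (step c y z)
    thus ?case using orth[of y] cinner_commute[of y x] by (simp add: cinner_add_left cinner_scaleC_left)
  qed simp
  obtain X where X: "\<And>n. X n \<in> cvec.span G" "X \<longlonglongrightarrow> x"
  proof -
    have "x \<in> closure (cvec.span G)" using G by simp
    thus ?thesis using that unfolding closure_sequential by blast
  qed
  have "(\<lambda>n. cinner (X n) x) \<longlonglongrightarrow> cinner x x"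
    by (rule bounded_linear.tendsto[OF bounded_linear_cinner_left X(2)])
  thus ?thesis unfolding s[OF X(1)] by (simp add: LIMSEQ_const_iff)
qed

section \<open>Orthonormal systems and operators given by coefficients\<close>

definition orthonormal :: "('i \<Rightarrow> 'a::complex_hilbert) \<Rightarrow> bool" where
  "orthonormal \<phi> \<longleftrightarrow> (\<forall>i j. cinner (\<phi> i) (\<phi> j) = (if i = j then 1 else 0))"

lemma orthonormal_cinner_sum:
  assumes "orthonormal \<phi>" "finite F"
  shows "cinner (\<Sum>i\<in>F. scaleC (c i) (\<phi> i)) (\<phi> k) = (if k \<in> F then c k else 0)"
proof -
  have "cinner (\<Sum>i\<in>F. scaleC (c i) (\<phi> i)) (\<phi> k) = (\<Sum>i\<in>F. if i = k then c i else 0)"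
    unfolding cinner_sum_left using assms(1)
    by (intro sum.cong) (auto simp: orthonormal_def cinner_scaleC_left)
  thus ?thesis using assms(2) by simp
qed

lemma orthonormal_norm_sum:
  assumes "orthonormal \<phi>" "finite F"
  shows "(norm (\<Sum>i\<in>F. scaleC (c i) (\<phi> i)))\<^sup>2 = (\<Sum>i\<in>F. (cmod (c i))\<^sup>2)"
proof -
  have "complex_of_real ((norm (\<Sum>i\<in>F. scaleC (c i) (\<phi> i)))\<^sup>2) = complex_of_real (\<Sum>i\<in>F. (cmod (c i))\<^sup>2)"
    unfolding cinner_norm[symmetric] using assms
    by (subst cinner_sum_right)
       (simp add: cinner_scaleC_right orthonormal_cinner_sum mult.commute flip: complex_norm_square)
  thus ?thesis by (simp only: of_real_eq_iff)
qed

lemma bessel: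
  assumes "orthonormal \<phi>" "finite F"
  shows "(\<Sum>i\<in>F. (cmod (cinner x (\<phi> i)))\<^sup>2) \<le> (norm x)\<^sup>2"
proof -
  define y where "y = (\<Sum>i\<in>F. scaleC (cinner x (\<phi> i)) (\<phi> i))"
  have "cinner (x - y) y = (\<Sum>i\<in>F. cnj (cinner x (\<phi> i)) * cinner (x - y) (\<phi> i))"
    by (subst (2) y_def) (simp add: cinner_sum_right cinner_scaleC_right)
  also have "\<dots> = 0"
    by (intro sum.neutral ballI)
       (simp add: cinner_diff_left y_def orthonormal_cinner_sum[OF assms])
  finally have "cinner (x - y) y = 0" .
  from norm_add_square_orthogonal[OF this] show ?thesis
    using orthonormal_norm_sum[OF assms, of "\<lambda>i. cinner x (\<phi> i)"] by (simp add: y_def)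
qed

text \<open>The partial sums of the orthonormal series are Cauchy. The hypothesis has the form that
  Bessel's inequality delivers, and the bound on the norm of \<open>x\<close> turns into an operator
  bound in \<open>ex_pullback_op\<close>.\<close>

lemma riesz_fischer:
  fixes \<phi> :: "nat \<Rightarrow> 'a::complex_hilbert"
  assumes on: "orthonormal \<phi>" and c: "\<And>n. (\<Sum>i<n. (cmod (c i))\<^sup>2) \<le> K\<^sup>2" and K: "0 \<le> K"
  shows "\<exists>x. (\<forall>k. cinner x (\<phi> k) = c k) \<and> norm x \<le> K"
proof -
  let ?g = "\<lambda>n. scaleC (c n) (\<phi> n)"
  have sq: "summable (\<lambda>n. (cmod (c n))\<^sup>2)"
    by (rule summableI_nonneg_bounded[of _ "K\<^sup>2"]) (use c in auto)
  have "summable ?g"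
    unfolding summable_Cauchy
  proof (intro allI impI)
    fix e :: real assume "e > 0"
    hence "e\<^sup>2 > 0" by simp
    from sq[unfolded summable_Cauchy, rule_format, OF this]
    obtain N where N: "\<And>m n. m \<ge> N \<Longrightarrow> norm (\<Sum>i\<in>{m..<n}. (cmod (c i))\<^sup>2) < e\<^sup>2"
      by auto
    have "norm (sum ?g {m..<n}) < e" if "m \<ge> N" for m n
    proof -
      have "(norm (sum ?g {m..<n}))\<^sup>2 < e\<^sup>2"
        using N[OF that, of n] by (simp add: orthonormal_norm_sum[OF on])
      thus ?thesis using \<open>e > 0\<close> by (simp add: power_less_imp_less_base)
    qed
    thus "\<exists>N. \<forall>m\<ge>N. \<forall>n. norm (sum ?g {m..<n}) < e" by blast
  qed
  then obtain x where x: "(\<lambda>n. sum ?g {..<n}) \<longlonglongrightarrow> x" by (auto simp: summable_def sums_def)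
  have "cinner x (\<phi> k) = c k" for k
  proof (rule LIMSEQ_unique)
    show "(\<lambda>n. cinner (sum ?g {..<n}) (\<phi> k)) \<longlonglongrightarrow> cinner x (\<phi> k)"
      by (rule bounded_linear.tendsto[OF bounded_linear_cinner_left x])
    have "eventually (\<lambda>n. cinner (sum ?g {..<n}) (\<phi> k) = c k) sequentially"
      using eventually_gt_at_top[of k] by eventually_elim (simp add: orthonormal_cinner_sum[OF on])
    thus "(\<lambda>n. cinner (sum ?g {..<n}) (\<phi> k)) \<longlonglongrightarrow> c k" by (rule tendsto_eventually)
  qed
  moreover have "norm x \<le> K"
  proof (rule tendsto_upperbound[OF tendsto_norm[OF x]])
    have "norm (sum ?g {..<n}) \<le> K" for n
      by (rule power2_le_imp_le[OF _ K]) (simp add: orthonormal_norm_sum[OF on] c)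
    thus "\<forall>\<^sub>F n in sequentially. norm (sum ?g {..<n}) \<le> K" by simp
  qed simp
  ultimately show ?thesis by blast
qed

text \<open>Completeness is expressed by a trivial orthogonal complement, which is the form needed
  to compare vectors by their coefficients.\<close>

definition complete_orthonormal :: "('i \<Rightarrow> 'a::complex_hilbert) \<Rightarrow> bool" where
  "complete_orthonormal \<phi> \<longleftrightarrow> orthonormal \<phi> \<and> (\<forall>x. (\<forall>i. cinner x (\<phi> i) = 0) \<longrightarrow> x = 0)"

lemma complete_orthonormal_eqI:
  assumes "complete_orthonormal \<phi>" "\<And>i. cinner x (\<phi> i) = cinner y (\<phi> i)"
  shows "x = y"
  using assms unfolding complete_orthonormal_def
  by (metis cinner_diff_left eq_iff_diff_eq_0)

text \<open>The common source of all operators below. Injectivity of \<open>\<tau>\<close> is asked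
  where \<open>a\<close> is nonzero, because the forward shift reads coefficient \<open>k\<close> at
  \<open>k - 1\<close>; this identifies 0 and 1, but its factor at 0 vanishes.\<close>

lemma ex_pullback_op:
  fixes \<phi> :: "nat \<Rightarrow> 'a::complex_hilbert"
  assumes \<phi>: "complete_orthonormal \<phi>" and a: "\<And>k. cmod (a k) \<le> M"
    and inj: "inj_on \<tau> {k. a k \<noteq> 0}"
  shows "\<exists>T. bounded_clinear T \<and> (\<forall>x k. cinner (T x) (\<phi> k) = a k * cinner x (\<phi> (\<tau> k)))"
proof -
  have on: "orthonormal \<phi>" using \<phi> by (simp add: complete_orthonormal_def)
  have M: "0 \<le> M" using a[of 0] norm_ge_zero order_trans by blast
  have "\<exists>y. (\<forall>k. cinner y (\<phi> k) = a k * cinner x (\<phi> (\<tau> k))) \<and> norm y \<le> M * norm x" for x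
  proof (rule riesz_fischer[OF on])
    fix n
    let ?I = "{k\<in>{..<n}. a k \<noteq> 0}"
    have "(\<Sum>i<n. (cmod (a i * cinner x (\<phi> (\<tau> i))))\<^sup>2) = (\<Sum>i\<in>?I. (cmod (a i * cinner x (\<phi> (\<tau> i))))\<^sup>2)"
      by (intro sum.mono_neutral_right) auto
    also have "\<dots> \<le> (\<Sum>i\<in>?I. M\<^sup>2 * (cmod (cinner x (\<phi> (\<tau> i))))\<^sup>2)"
      by (intro sum_mono) (auto simp: norm_mult power_mult_distrib intro!: mult_right_mono power_mono a)
    \<comment> \<open>Injectivity on the support of \<open>a\<close> makes the basis vectors
      distinct, so that Bessel's inequality applies to the image.\<close>
    also have "\<dots> = M\<^sup>2 * (\<Sum>i\<in>\<tau> ` ?I. (cmod (cinner x (\<phi> i)))\<^sup>2)"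
      by (subst sum.reindex) (auto simp: sum_distrib_left intro: inj_on_subset[OF inj])
    also have "\<dots> \<le> M\<^sup>2 * (norm x)\<^sup>2"
      by (intro mult_left_mono bessel on) auto
    finally show "(\<Sum>i<n. (cmod (a i * cinner x (\<phi> (\<tau> i))))\<^sup>2) \<le> (M * norm x)\<^sup>2"
      by (simp add: power_mult_distrib)
  qed (use M in auto)
  then obtain T where T: "\<And>x k. cinner (T x) (\<phi> k) = a k * cinner x (\<phi> (\<tau> k))"
    and nT: "\<And>x. norm (T x) \<le> M * norm x" by metis
  have sc: "T (scaleC c x) = scaleC c (T x)" for c x
    by (rule complete_orthonormal_eqI[OF \<phi>]) (simp add: T cinner_scaleC_left)
  have "bounded_linear T"
  proof (rule bounded_linear_intro[where K = M])
    show "T (x + y) = T x + T y" for x y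
      by (rule complete_orthonormal_eqI[OF \<phi>]) (simp add: T cinner_add_left distrib_left)
  qed (use nT sc in \<open>simp_all add: scaleR_scaleC mult.commute\<close>)
  thus ?thesis using T sc unfolding bounded_clinear_def by blast
qed

section \<open>Shift operators and tensor products in coordinates\<close>

lemma cinner_hardy_monom: "cinner f (hardy_monom k) = hardy_coeff f k"
proof -
  have "cinner f (hardy_monom k) = (\<Sum>n\<in>{k}. hardy_coeff f n * cnj (hardy_coeff (hardy_monom k) n))"
    unfolding cinner_hardy_def by (rule suminf_finite) (auto simp: hardy_coeff_monom)
  thus ?thesis by (simp add: hardy_coeff_monom)
qed

lemma complete_orthonormal_hardy_monom: "complete_orthonormal hardy_monom"
  unfolding complete_orthonormal_def orthonormal_def
  by (auto simp: cinner_hardy_monom hardy_coeff_monom hardy_coeff_zero intro: hardy_eqI)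

lemma closure_span_hardy_monom: "closure (cvec.span (range hardy_monom)) = UNIV"
proof -
  have "f \<in> closure (cvec.span (range hardy_monom))" for f
    unfolding closure_sequential
  proof (intro exI conjI allI)
    show "(\<lambda>m. \<Sum>i<m. scaleC (hardy_coeff f i) (hardy_monom i)) \<longlonglongrightarrow> f"
      using hardy_expansion[of f] by (simp add: sums_def)
  qed (intro cvec.span_sum cvec.span_scale cvec.span_base rangeI)
  thus ?thesis by blast
qed

text \<open>Applied to each tensor factor separately in order to pass from monomials to arbitrary
  functions.\<close>

lemma hardy_linear_functional_eq_0:
  fixes g :: "hardy \<Rightarrow> complex"
  assumes "bounded_linear g" "\<And>c f. g (scaleC c f) = c * g f" "\<And>k. g (hardy_monom k) = 0"
  shows "g f = 0"
proof -
  have "(\<lambda>n. g (scaleC (hardy_coeff f n) (hardy_monom n))) sums g f"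
    by (rule bounded_linear.sums[OF assms(1) hardy_expansion])
  thus ?thesis by (simp add: assms(2,3) sums_0 sums_iff)
qed

lemma hardy_coeff_weighted_shift:
  assumes "bounded (range w)"
  shows "hardy_coeff (weighted_shift w f) k =
      (if k = 0 then 0 else complex_of_real (w (k - 1))) * hardy_coeff f (k - 1)"
proof -
  obtain M where M: "\<And>i. \<bar>w i\<bar> \<le> M" using assms by (auto simp: bounded_iff)
  have M0: "0 \<le> M" using M[of 0] by simp
  let ?P = "\<lambda>S. bounded_clinear S \<and>
     (\<forall>i. S (hardy_monom i) = scaleC (complex_of_real (w i)) (hardy_monom (Suc i)))"
  have "\<exists>T. bounded_clinear T \<and> (\<forall>x k. cinner (T x) (hardy_monom k) =
      (if k = 0 then 0 else complex_of_real (w (k - 1))) * cinner x (hardy_monom (k - 1)))"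
    by (rule ex_pullback_op[OF complete_orthonormal_hardy_monom, where M = M])
       (use M M0 in \<open>auto simp: inj_on_def\<close>)
  then obtain T where T: "bounded_clinear T" and Tc: "\<And>f k. hardy_coeff (T f) k =
      (if k = 0 then 0 else complex_of_real (w (k - 1))) * hardy_coeff f (k - 1)"
    by (auto simp: cinner_hardy_monom)
  have P: "?P T"
    using T by (auto intro!: hardy_eqI simp: Tc hardy_coeff_monom hardy_coeff_scaleC)
  have "weighted_shift w = T"
    unfolding weighted_shift_def
  proof (rule the_equality)
    fix S assume "?P S"
    with P show "S = T"
      by (intro bounded_clinear_eqI[OF _ _ closure_span_hardy_monom]) auto
  qed (rule P)
  thus ?thesis by (simp add: Tc)
qed

lemma hardy_coeff_adjoint_weighted_shift:
  assumes "bounded (range w)"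
  shows "hardy_coeff (adjoint_op (weighted_shift w) f) k = complex_of_real (w k) * hardy_coeff f (Suc k)"
proof -
  obtain M where M: "\<And>i. \<bar>w i\<bar> \<le> M" using assms by (auto simp: bounded_iff)
  let ?S = "weighted_shift w"
  let ?P = "\<lambda>B. bounded_clinear B \<and> (\<forall>x y. cinner (?S x) y = cinner x (B y))"
  have "\<exists>T. bounded_clinear T \<and> (\<forall>x k. cinner (T x) (hardy_monom k) =
      complex_of_real (w k) * cinner x (hardy_monom (Suc k)))"
    by (rule ex_pullback_op[OF complete_orthonormal_hardy_monom, where M = M]) (use M in auto)
  then obtain T where T: "bounded_clinear T" and Tc: "\<And>f k. hardy_coeff (T f) k =
      complex_of_real (w k) * hardy_coeff f (Suc k)"
    by (auto simp: cinner_hardy_monom)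
  have "cinner (?S x) y = cinner x (T y)" for x y
  proof -
    \<comment> \<open>The coefficient of a shifted function at 0 vanishes, so the sum may start at
      1.\<close>
    have "cinner (?S x) y = (\<Sum>n. hardy_coeff (?S x) (Suc n) * cnj (hardy_coeff y (Suc n)))"
      using suminf_split_head[OF hardy_cinner_summable, of "?S x" y]
      by (simp add: cinner_hardy_def hardy_coeff_weighted_shift[OF assms])
    also have "\<dots> = cinner x (T y)"
      by (simp add: cinner_hardy_def hardy_coeff_weighted_shift[OF assms] Tc mult_ac)
    finally show ?thesis .
  qed
  hence P: "?P T" using T by blast
  have "adjoint_op ?S = T"
    unfolding adjoint_op_def
  proof (rule the_equality)
    fix B assume B: "?P B"
    show "B = T"
    proof
      fix y
      have "cinner z (B y) = cinner z (T y)" for z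
        by (rule trans[OF B[THEN conjunct2, rule_format, symmetric] P[THEN conjunct2, rule_format]])
      hence "cinner (B y - T y) (B y - T y) = 0" by (subst cinner_diff_right) simp
      thus "B y = T y" by simp
    qed
  qed (rule P)
  thus ?thesis by (simp add: Tc)
qed

section \<open>Coordinates in the tensor product\<close>

locale hardy_tensor =
  fixes tns :: "hardy \<Rightarrow> hardy \<Rightarrow> 't::complex_hilbert"
  assumes tensor: "hilbert_tensor tns"
begin

definition E :: "nat \<Rightarrow> nat \<Rightarrow> 't" where "E i j = tns (hardy_monom i) (hardy_monom j)"

definition coef :: "'t \<Rightarrow> nat \<Rightarrow> nat \<Rightarrow> complex" where "coef x i j = cinner x (E i j)"

lemma cinner_tns: "cinner (tns u v) (tns u' v') = cinner u u' * cinner v v'"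
  using tensor by (simp add: hilbert_tensor_def)

lemma tns_add: "tns (u + u') v = tns u v + tns u' v" "tns u (v + v') = tns u v + tns u v'"
  and tns_scaleC: "tns (scaleC c u) v = scaleC c (tns u v)" "tns u (scaleC c v) = scaleC c (tns u v)"
  using tensor by (simp_all add: hilbert_tensor_def)

lemma closure_span_tns: "closure (cvec.span {tns u v | u v. True}) = UNIV"
  using tensor by (simp add: hilbert_tensor_def)

lemma coef_tns: "coef (tns u v) i j = hardy_coeff u i * hardy_coeff v j"
  by (simp add: coef_def E_def cinner_tns cinner_hardy_monom)

lemma coef_E: "coef (E k l) i j = (if k = i \<and> l = j then 1 else 0)"
  by (simp add: E_def coef_tns hardy_coeff_monom)

lemma coef_linear:
  "coef (x + y) i j = coef x i j + coef y i j" "coef (scaleC c x) i j = c * coef x i j"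
  "coef (x - y) i j = coef x i j - coef y i j" "coef (- x) i j = - coef x i j" "coef 0 i j = 0"
  "coef (sum f A) i j = (\<Sum>k\<in>A. coef (f k) i j)"
  by (simp_all add: coef_def cinner_add_left cinner_scaleC_left cinner_diff_left cinner_minus_left
      cinner_sum_left)

lemma norm_tns: "norm (tns u v) = norm u * norm v"
proof -
  have "complex_of_real ((norm (tns u v))\<^sup>2) = complex_of_real ((norm u * norm v)\<^sup>2)"
    by (simp only: cinner_norm[symmetric] cinner_tns power_mult_distrib) (simp add: cinner_norm)
  hence "(norm (tns u v))\<^sup>2 = (norm u * norm v)\<^sup>2" by (simp only: of_real_eq_iff)
  thus ?thesis by simp
qed

lemma bounded_linear_tns: "bounded_linear (\<lambda>u. tns u v)" "bounded_linear (\<lambda>v. tns u v)"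
proof -
  show "bounded_linear (\<lambda>u. tns u v)"
    by (rule bounded_linear_intro[where K = "norm v"])
       (simp_all add: scaleR_scaleC tns_add tns_scaleC norm_tns)
  show "bounded_linear (\<lambda>v. tns u v)"
    by (rule bounded_linear_intro[where K = "norm u"])
       (simp_all add: scaleR_scaleC tns_add tns_scaleC norm_tns mult.commute)
qed

text \<open>Orthogonality to the \<open>E i j\<close> extends by continuity in the first factor,
  then in the second, to all elementary tensors, and their span is dense.\<close>

lemma eq_0_if_coef_eq_0:
  assumes "\<And>i j. coef x i j = 0"
  shows "x = 0"
proof (rule orthogonal_to_dense_eq_0[OF closure_span_tns])
  have *: "cinner (tns (hardy_monom i) (hardy_monom j)) x = 0" for i j
    using assms[of i j] cinner_commute[of "E i j" x] by (simp add: coef_def E_def)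
  have **: "cinner (tns u (hardy_monom j)) x = 0" for u j
    by (rule hardy_linear_functional_eq_0[OF bounded_linear_compose[OF bounded_linear_cinner_left
          bounded_linear_tns(1)]])
       (simp_all add: * tns_scaleC cinner_scaleC_left)
  have "cinner (tns u v) x = 0" for u v
    by (rule hardy_linear_functional_eq_0[OF bounded_linear_compose[OF bounded_linear_cinner_left
          bounded_linear_tns(2)]])
       (simp_all add: ** tns_scaleC cinner_scaleC_left)
  thus "cinner x y = 0" if "y \<in> {tns u v |u v. True}" for y
    using that cinner_commute[of x y] by auto
qed

lemma coef_eqI: "(\<And>i j. coef x i j = coef y i j) \<Longrightarrow> x = y"
  using eq_0_if_coef_eq_0[of "x - y"] by (simp add: coef_linear)

text \<open>The pairing function turns the double index into the single natural number that
  \<open>ex_pullback_op\<close> expects.\<close>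

lemma complete_orthonormal_E:
  "complete_orthonormal (\<lambda>n. E (fst (prod_decode n)) (snd (prod_decode n)))"
  unfolding complete_orthonormal_def
proof (intro conjI allI impI)
  show "orthonormal (\<lambda>n. E (fst (prod_decode n)) (snd (prod_decode n)))"
    unfolding orthonormal_def coef_def[symmetric] coef_E
    by (metis prod_decode_inverse prod_eq_iff)
next
  fix x assume *: "\<forall>i. cinner x (E (fst (prod_decode i)) (snd (prod_decode i))) = 0"
  show "x = 0"
  proof (rule eq_0_if_coef_eq_0)
    show "coef x i j = 0" for i j
      using *[rule_format, of "prod_encode (i, j)"] by (simp add: coef_def)
  qed
qed

lemma ex_tensor_pullback:
  assumes a: "\<And>i j. cmod (a i j) \<le> M" and inj: "inj_on \<tau> {(i, j). a i j \<noteq> 0}"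
  shows "\<exists>T. bounded_clinear T \<and>
    (\<forall>x i j. coef (T x) i j = a i j * coef x (fst (\<tau> (i, j))) (snd (\<tau> (i, j))))"
proof -
  have "inj_on (\<lambda>n. prod_encode (\<tau> (prod_decode n)))
      {n. a (fst (prod_decode n)) (snd (prod_decode n)) \<noteq> 0}"
  proof (rule inj_onI)
    fix m n
    assume mn: "m \<in> {n. a (fst (prod_decode n)) (snd (prod_decode n)) \<noteq> 0}"
      "n \<in> {n. a (fst (prod_decode n)) (snd (prod_decode n)) \<noteq> 0}"
      "prod_encode (\<tau> (prod_decode m)) = prod_encode (\<tau> (prod_decode n))"
    hence "\<tau> (prod_decode m) = \<tau> (prod_decode n)" by simp
    hence "prod_decode m = prod_decode n"
      by (rule inj_onD[OF inj]) (use mn in \<open>auto simp: case_prod_unfold\<close>)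
    thus "m = n" by simp
  qed
  from ex_pullback_op[OF complete_orthonormal_E a this]
  obtain T where T: "bounded_clinear T" and Tc: "\<And>x k. cinner (T x) (E (fst (prod_decode k)) (snd (prod_decode k))) =
      a (fst (prod_decode k)) (snd (prod_decode k)) *
      cinner x (E (fst (\<tau> (prod_decode k))) (snd (\<tau> (prod_decode k))))"
    by auto
  have "coef (T x) i j = a i j * coef x (fst (\<tau> (i, j))) (snd (\<tau> (i, j)))" for x i j
    using Tc[of x "prod_encode (i, j)"] by (simp add: coef_def)
  with T show ?thesis by blast
qed

text \<open>Tensor products are constructed for factors that act by scaling and reindexing
  coefficients; such a product acts in the same way on pairs of indices, with the product of the
  factors' scalars.\<close>

lemma coef_tensor_op:
  assumes A: "\<And>f k. hardy_coeff (A f) k = \<alpha> k * hardy_coeff f (\<sigma> k)"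
    and B: "\<And>f k. hardy_coeff (B f) k = \<beta> k * hardy_coeff f (\<sigma>' k)"
    and bd: "\<And>k. cmod (\<alpha> k) \<le> M" "\<And>k. cmod (\<beta> k) \<le> M'"
    and inj: "inj_on \<sigma> {k. \<alpha> k \<noteq> 0}" "inj_on \<sigma>' {k. \<beta> k \<noteq> 0}"
  shows "coef (tensor_op tns A B x) i j = \<alpha> i * \<beta> j * coef x (\<sigma> i) (\<sigma>' j)"
proof -
  let ?P = "\<lambda>T. bounded_clinear T \<and> (\<forall>u v. T (tns u v) = tns (A u) (B v))"
  have "0 \<le> M" using bd(1)[of 0] norm_ge_zero order_trans by blast
  hence "cmod (\<alpha> i * \<beta> j) \<le> M * M'" for i j
    unfolding norm_mult by (intro mult_mono bd) auto
  moreover have "inj_on (map_prod \<sigma> \<sigma>') {(i, j). \<alpha> i * \<beta> j \<noteq> 0}"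
    using inj by (auto simp: inj_on_def)
  ultimately obtain T where T: "bounded_clinear T"
    and Tc: "\<And>x i j. coef (T x) i j = \<alpha> i * \<beta> j * coef x (\<sigma> i) (\<sigma>' j)"
    using ex_tensor_pullback[of "\<lambda>i j. \<alpha> i * \<beta> j" "M * M'" "map_prod \<sigma> \<sigma>'"] by auto
  have P: "?P T" using T by (auto intro!: coef_eqI simp: Tc coef_tns A B)
  have "tensor_op tns A B = T"
    unfolding tensor_op_def
  proof (rule the_equality)
    fix S assume "?P S"
    with P show "S = T" by (intro bounded_clinear_eqI[OF _ _ closure_span_tns]) auto
  qed (rule P)
  thus ?thesis by (simp add: Tc)
qed

lemma coef_flip_op: "coef (flip_op tns x) i j = coef x j i"
proof -
  let ?P = "\<lambda>F. bounded_clinear F \<and> (\<forall>u v. F (tns u v) = tns v u)"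
  obtain T where T: "bounded_clinear T" and Tc: "\<And>x i j. coef (T x) i j = coef x j i"
    using ex_tensor_pullback[of "\<lambda>i j. 1" 1 prod.swap] by auto
  have P: "?P T" using T by (auto intro!: coef_eqI simp: Tc coef_tns)
  have "flip_op tns = T"
    unfolding flip_op_def
  proof (rule the_equality)
    fix S assume "?P S"
    with P show "S = T" by (intro bounded_clinear_eqI[OF _ _ closure_span_tns]) auto
  qed (rule P)
  thus ?thesis by (simp add: Tc)
qed

text \<open>The shift reads one index lower and its adjoint one index higher, so each summand refers
  to a coefficient on the same antidiagonal.\<close>

lemma coef_tensor_shift:
  assumes "bounded (range w)"
  defines "S \<equiv> weighted_shift w"
  shows "coef (scaleC (1/2) (tensor_op tns S (adjoint_op S) x + tensor_op tns (adjoint_op S) S x)) i j =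
    (if i = 0 then 0 else complex_of_real (w (i - 1) * w j / 2) * coef x (i - 1) (Suc j)) +
    (if j = 0 then 0 else complex_of_real (w i * w (j - 1) / 2) * coef x (Suc i) (j - 1))"
proof -
  obtain M where M: "\<And>i. \<bar>w i\<bar> \<le> M" using assms by (auto simp: bounded_iff)
  have M0: "0 \<le> M" using M[of 0] by simp
  note S = hardy_coeff_weighted_shift[OF assms(1), folded S_def]
  note S' = hardy_coeff_adjoint_weighted_shift[OF assms(1), folded S_def]
  have b: "cmod (if k = 0 then 0 else complex_of_real (w (k - 1))) \<le> M" "cmod (complex_of_real (w k)) \<le> M" for k
    using M M0 by auto
  have inj: "inj_on (\<lambda>k::nat. k - 1) {k. (if k = 0 then 0 else complex_of_real (w (k - 1))) \<noteq> 0}"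
    "inj_on Suc {k. complex_of_real (w k) \<noteq> 0}"
    by (auto simp: inj_on_def)
  show ?thesis
    by (simp add: coef_linear coef_tensor_op[OF S S' b inj] coef_tensor_op[OF S' S b(2,1) inj(2,1)]
        distrib_left)
qed

end

section \<open>Tridiagonal matrices\<close>

text \<open>Characteristic polynomials of the leading blocks of a tridiagonal matrix with diagonal
  \<open>d\<close>, expanded along the last row. Here \<open>\<beta> i\<close> is the product of the
  two entries linking rows \<open>i\<close> and \<open>i + 1\<close>; the determinant depends on
  these entries through their product.\<close>

fun jac :: "(nat \<Rightarrow> real) \<Rightarrow> (nat \<Rightarrow> real) \<Rightarrow> nat \<Rightarrow> complex poly" where
  "jac d \<beta> 0 = 1"
| "jac d \<beta> (Suc 0) = [:- complex_of_real (d 0), 1:]"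
| "jac d \<beta> (Suc (Suc m)) = [:- complex_of_real (d (Suc m)), 1:] * jac d \<beta> (Suc m)
     - smult (complex_of_real (\<beta> m)) (jac d \<beta> m)"

lemma jac_Suc:
  "jac d \<beta> (Suc n) = [:- complex_of_real (d n), 1:] * jac d \<beta> n
     - (if n = 0 then 0 else smult (complex_of_real (\<beta> (n - 1))) (jac d \<beta> (n - 1)))"
  by (cases n) simp_all

lemma jac_cong:
  assumes "\<And>i. i < n \<Longrightarrow> d i = d' i" "\<And>i. Suc i < n \<Longrightarrow> \<beta> i = \<beta>' i"
  shows "jac d \<beta> n = jac d' \<beta>' n"
  using assms by (induction d \<beta> n rule: jac.induct) (simp_all del: mult_pCons_left)

lemma degree_jac: "degree (jac d \<beta> n) \<le> n \<and> coeff (jac d \<beta> n) n = 1"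
proof (induction d \<beta> n rule: jac.induct)
  case (3 d \<beta> m)
  have "coeff (jac d \<beta> (Suc m)) (Suc (Suc m)) = 0" "coeff (jac d \<beta> m) (Suc (Suc m)) = 0"
    using 3 by (simp_all add: coeff_eq_0)
  moreover have "degree (jac d \<beta> (Suc (Suc m))) \<le> Suc (Suc m)"
    unfolding jac.simps
    by (intro degree_diff_le order_trans[OF degree_mult_le] order_trans[OF degree_smult_le])
       (use 3 in auto)
  ultimately show ?case using 3 by simp
qed simp_all

lemma jac_nonzero: "jac d \<beta> n \<noteq> 0"
  using degree_jac[of d \<beta> n] by auto

text \<open>At \<open>m = 1\<close> the second term of the recurrence drops out, so the recurrence
  restarts as for a new matrix; from there on both sides obey the same recurrence.\<close>

lemma jac_split:
  assumes "\<beta> k = 0"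
  shows "jac d \<beta> (Suc k + m) =
    jac d \<beta> (Suc k) * jac (\<lambda>i. d (Suc k + i)) (\<lambda>i. \<beta> (Suc k + i)) m"
proof (induction m rule: less_induct)
  case (less m)
  consider "m = 0" | "m = 1" | l where "m = Suc (Suc l)"
    by (metis One_nat_def not0_implies_Suc)
  thus ?case
  proof cases
    case 2
    thus ?thesis using assms by simp
  next
    case 3
    have "jac d \<beta> (Suc k + m) = [:- complex_of_real (d (Suc k + Suc l)), 1:] * jac d \<beta> (Suc k + Suc l)
        - smult (complex_of_real (\<beta> (Suc k + l))) (jac d \<beta> (Suc k + l))"
      by (simp add: 3 del: mult_pCons_left)
    also have "\<dots> = jac d \<beta> (Suc k) * jac (\<lambda>i. d (Suc k + i)) (\<lambda>i. \<beta> (Suc k + i)) m"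
      using less.IH[of l] less.IH[of "Suc l"] by (simp only: 3 jac.simps) (simp add: algebra_simps)
    finally show ?thesis .
  qed simp
qed

text \<open>The ratio of consecutive polynomials maps each open half-plane into itself. Multiplying
  by the conjugate instead of dividing gives a quantity whose positivity propagates along the
  recurrence: a conjugation and the minus sign combine to a positive multiple of the previous
  quantity.\<close>

lemma jac_nonreal_nonzero:
  assumes \<beta>: "\<And>i. Suc i < n \<Longrightarrow> 0 \<le> \<beta> i" and z: "Im z \<noteq> 0"
  shows "poly (jac d \<beta> n) z \<noteq> 0"
proof (cases n)
  case (Suc m)
  let ?P = "\<lambda>n. poly (jac d \<beta> n) z"
  have "0 < Im z * Im (?P (Suc k) * cnj (?P k))" if "k \<le> m" for k
    using that
  proof (induction k)
    case (Suc k)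
    have "?P (Suc k) \<noteq> 0" using Suc by auto
    hence 1: "0 < (Im z)\<^sup>2 * (cmod (?P (Suc k)))\<^sup>2" using z by simp
    have 2: "0 \<le> \<beta> k * (Im z * Im (?P (Suc k) * cnj (?P k)))"
      using Suc \<beta>[of k] \<open>n = Suc m\<close> by simp
    have "?P (Suc (Suc k)) * cnj (?P (Suc k)) =
        (z - complex_of_real (d (Suc k))) * complex_of_real ((cmod (?P (Suc k)))\<^sup>2) -
        complex_of_real (\<beta> k) * cnj (?P (Suc k) * cnj (?P k))"
      by (simp add: complex_norm_square algebra_simps del: of_real_power)
    hence "Im (?P (Suc (Suc k)) * cnj (?P (Suc k))) =
        Im z * (cmod (?P (Suc k)))\<^sup>2 + \<beta> k * Im (?P (Suc k) * cnj (?P k))"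
      by (simp only: minus_complex.simps times_complex.simps Re_complex_of_real Im_complex_of_real
          complex_cnj) (simp add: algebra_simps)
    hence "Im z * Im (?P (Suc (Suc k)) * cnj (?P (Suc k))) =
        (Im z)\<^sup>2 * (cmod (?P (Suc k)))\<^sup>2 + \<beta> k * (Im z * Im (?P (Suc k) * cnj (?P k)))"
      by (simp only:) (simp add: power2_eq_square algebra_simps)
    thus ?case using 1 2 by linarith
  qed (use z in \<open>auto simp: zero_less_mult_iff\<close>)
  from this[of m] show ?thesis using Suc by auto
qed simp

lemma jac_Reals:
  assumes "z \<in> \<real>"
  shows "poly (jac d \<beta> n) z \<in> \<real>"
  using assms by (induction d \<beta> n rule: jac.induct) simp_all

text \<open>The Wronskian of consecutive polynomials is positive on the real line, so no root is multiple.\<close>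

lemma jac_simple_root:
  assumes \<beta>: "\<And>i. Suc i < n \<Longrightarrow> 0 < \<beta> i" and root: "poly (jac d \<beta> n) z = 0"
  shows "order z (jac d \<beta> n) = 1"
proof -
  obtain m where n: "n = Suc m" using root by (cases n) auto
  have z: "z \<in> \<real>"
    using jac_nonreal_nonzero[of n \<beta> z d] \<beta> root by (auto simp: complex_is_Real_iff less_imp_le)
  let ?P = "\<lambda>n. poly (jac d \<beta> n) z" and ?P' = "\<lambda>n. poly (pderiv (jac d \<beta> n)) z"
  have "0 < Re (?P' (Suc k) * ?P k - ?P (Suc k) * ?P' k)" if "k \<le> m" for k
    using that
  proof (induction k)
    case (Suc k)
    obtain r where r: "?P (Suc k) = complex_of_real r"
      using jac_Reals[OF z, of d \<beta> "Suc k"] by (auto elim: Reals_cases)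
    let ?W = "\<lambda>k. ?P' (Suc k) * ?P k - ?P (Suc k) * ?P' k"
    \<comment> \<open>The terms with \<open>d\<close> cancel. The first summand is the square of a
      real number, since \<open>z\<close> is real.\<close>
    have "?W (Suc k) = ?P (Suc k) * ?P (Suc k) + complex_of_real (\<beta> k) * ?W k"
      by (simp add: pderiv_diff pderiv_add pderiv_smult pderiv_pCons algebra_simps)
    hence W: "Re (?W (Suc k)) = r * r + \<beta> k * Re (?W k)"
      unfolding r by (simp only:) simp
    have "0 < \<beta> k * Re (?W k)" using Suc \<beta>[of k] n by (intro mult_pos_pos) auto
    thus ?case unfolding W by (simp add: add_nonneg_pos)
  qed (simp add: pderiv_pCons)
  \<comment> \<open>At a root the Wronskian reduces to the derivative times the preceding
    polynomial.\<close>
  from this[of m] have "?P' n \<noteq> 0" using root n by auto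
  hence "order z (pderiv (jac d \<beta> n)) = 0" "pderiv (jac d \<beta> n) \<noteq> 0"
    by (auto simp: order_root)
  thus ?thesis
    using order_pderiv[of "jac d \<beta> n" z] root jac_nonzero[of d \<beta> n] by (simp add: order_root)
qed

text \<open>The eigenvector equation, row by row, of the matrix with superdiagonal \<open>b\<close>,
  subdiagonal \<open>c\<close> and diagonal \<open>d\<close>; values of \<open>x\<close> from
  \<open>n\<close> on are ignored.\<close>

definition tri_eq :: "(nat \<Rightarrow> real) \<Rightarrow> (nat \<Rightarrow> real) \<Rightarrow> (nat \<Rightarrow> real) \<Rightarrow> nat \<Rightarrow> complex \<Rightarrow> (nat \<Rightarrow> complex) \<Rightarrow> bool"
  where "tri_eq b c d n \<mu> x \<longleftrightarrow> (\<forall>i<n.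
    (if i = 0 then 0 else complex_of_real (c (i - 1)) * x (i - 1)) + complex_of_real (d i) * x i +
    (if Suc i < n then complex_of_real (b i) * x (Suc i) else 0) = \<mu> * x i)"

lemma tri_eq_cong:
  assumes "\<And>i. i < n \<Longrightarrow> x i = y i"
  shows "tri_eq b c d n \<mu> x \<longleftrightarrow> tri_eq b c d n \<mu> y"
  unfolding tri_eq_def
proof (intro all_cong1 imp_cong refl)
  fix i assume "i < n"
  hence "x i = y i" "x (i - 1) = y (i - 1)" "Suc i < n \<Longrightarrow> x (Suc i) = y (Suc i)"
    using assms by auto
  thus "(if i = 0 then 0 else complex_of_real (c (i - 1)) * x (i - 1)) + complex_of_real (d i) * x i +
      (if Suc i < n then complex_of_real (b i) * x (Suc i) else 0) = \<mu> * x i \<longleftrightarrow>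
    (if i = 0 then 0 else complex_of_real (c (i - 1)) * y (i - 1)) + complex_of_real (d i) * y i +
      (if Suc i < n then complex_of_real (b i) * y (Suc i) else 0) = \<mu> * y i"
    by simp
qed

text \<open>As no \<open>b i\<close> vanishes, each row except the last determines the next entry
  from the previous ones, hence everything from \<open>x 0\<close>; the last row becomes the
  characteristic equation. The eigenspace is therefore at most one-dimensional.\<close>

lemma tri_eq_irreducible:
  fixes b c d :: "nat \<Rightarrow> real" and \<mu> :: complex and x :: "nat \<Rightarrow> complex"
  assumes pos: "\<And>i. Suc i < n \<Longrightarrow> 0 < b i * c i" and n: "0 < n"
  defines "P \<equiv> \<lambda>i. poly (jac d (\<lambda>i. b i * c i) i) \<mu>"
  defines "v \<equiv> \<lambda>i. P i / complex_of_real (\<Prod>j<i. b j)"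
  shows "tri_eq b c d n \<mu> x \<longleftrightarrow> (\<forall>i<n. x i = x 0 * v i) \<and> (P n = 0 \<or> x 0 = 0)"
proof -
  have b0: "b i \<noteq> 0" if "Suc i < n" for i using pos[OF that] by auto
  have P: "P (Suc i) = (\<mu> - complex_of_real (d i)) * P i -
      (if i = 0 then 0 else complex_of_real (b (i - 1) * c (i - 1)) * P (i - 1))" for i
    unfolding P_def by (subst jac_Suc) (simp add: algebra_simps)
  have pr: "(\<Prod>j<i. b j) \<noteq> 0" if "i < n" for i using that b0 by auto
  \<comment> \<open>The quotient with \<open>P (Suc i)\<close> stands for \<open>b i\<close> times
    the next entry of \<open>v\<close>, but it also makes sense in the last row, where it measures
    the failure of the equation.\<close>
  have v: "(if i = 0 then 0 else complex_of_real (c (i - 1)) * v (i - 1)) +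
      complex_of_real (d i) * v i + P (Suc i) / complex_of_real (\<Prod>j<i. b j) = \<mu> * v i"
    if "i < n" for i
  proof (cases i)
    case (Suc k)
    have "complex_of_real (b k) \<noteq> 0" "complex_of_real (\<Prod>j<k. b j) \<noteq> 0"
      using b0[of k] pr[of k] Suc that by (simp_all del: of_real_prod)
    thus ?thesis using pr[OF that] P[of i] Suc by (simp add: v_def field_simps del: of_real_prod)
  qed (simp add: v_def P algebra_simps)
  have bv: "complex_of_real (b i) * v (Suc i) = P (Suc i) / complex_of_real (\<Prod>j<i. b j)"
    if "Suc i < n" for i
    using b0[OF that] by (simp add: v_def del: of_real_prod)
  have v0: "v 0 = 1" by (simp add: v_def P_def)
  show ?thesis
  proof
    assume x: "tri_eq b c d n \<mu> x"
    have xv: "x i = x 0 * v i" if "i < n" for i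
      using that
    proof (induction i rule: less_induct)
      case (less i)
      show ?case
      proof (cases i)
        case (Suc k)
        have k: "k < n" "Suc k < n" using less Suc by auto
        have "complex_of_real (b k) * x (Suc k) = \<mu> * x k -
            ((if k = 0 then 0 else complex_of_real (c (k - 1)) * x (k - 1)) + complex_of_real (d k) * x k)"
          using x[unfolded tri_eq_def, rule_format, OF k(1)] k(2) by (simp add: eq_diff_eq add.commute)
        also have "\<dots> = x 0 * (\<mu> * v k -
            ((if k = 0 then 0 else complex_of_real (c (k - 1)) * v (k - 1)) + complex_of_real (d k) * v k))"
        proof -
          have xs: "x k = x 0 * v k" "x (k - 1) = x 0 * v (k - 1)"
            by (rule less.IH; use k Suc in simp)+
          show ?thesis unfolding xs by (simp add: algebra_simps)
        qed
        also have "\<dots> = x 0 * (complex_of_real (b k) * v (Suc k))"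
          unfolding bv[OF k(2)] v[OF k(1), symmetric] by (simp only: add_diff_cancel_left')
        also have "\<dots> = complex_of_real (b k) * (x 0 * v (Suc k))" by (rule mult.left_commute)
        finally have "complex_of_real (b k) * x (Suc k) = complex_of_real (b k) * (x 0 * v (Suc k))" .
        thus ?thesis using b0[OF k(2)] Suc by simp
      qed (simp add: v0)
    qed
    \<comment> \<open>The last row has no superdiagonal term, so the quotient with
      \<open>P n\<close>, multiplied by \<open>x 0\<close>, must vanish.\<close>
    let ?m = "n - 1"
    have m: "?m < n" "Suc ?m = n" using n by auto
    have "x 0 * (P n / complex_of_real (\<Prod>j<?m. b j)) = x 0 * (\<mu> * v ?m -
        ((if ?m = 0 then 0 else complex_of_real (c (?m - 1)) * v (?m - 1)) + complex_of_real (d ?m) * v ?m))"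
      by (simp only: v[OF m(1), symmetric] m(2)) simp
    also have "\<dots> = \<mu> * x ?m -
        ((if ?m = 0 then 0 else complex_of_real (c (?m - 1)) * x (?m - 1)) + complex_of_real (d ?m) * x ?m)"
    proof -
      have xs: "x ?m = x 0 * v ?m" "x (?m - 1) = x 0 * v (?m - 1)" by (rule xv; use m in simp)+
      show ?thesis unfolding xs by (simp add: algebra_simps)
    qed
    also have "\<dots> = 0"
      using x[unfolded tri_eq_def, rule_format, OF m(1)] m by simp
    finally have "x 0 * (P n / complex_of_real (\<Prod>j<?m. b j)) = 0" .
    hence "P n = 0 \<or> x 0 = 0" using pr[OF m(1)] by (auto simp del: of_real_prod)
    with xv show "(\<forall>i<n. x i = x 0 * v i) \<and> (P n = 0 \<or> x 0 = 0)" by blast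
  next
    assume *: "(\<forall>i<n. x i = x 0 * v i) \<and> (P n = 0 \<or> x 0 = 0)"
    show "tri_eq b c d n \<mu> x"
      unfolding tri_eq_def
    proof (intro allI impI)
      fix i assume i: "i < n"
      have xs: "x i = x 0 * v i" "x (i - 1) = x 0 * v (i - 1)"
        using i * by (blast, meson diff_le_self le_less_trans)
      have "(if Suc i < n then complex_of_real (b i) * x (Suc i) else 0) =
          x 0 * (P (Suc i) / complex_of_real (\<Prod>j<i. b j))"
      proof (cases "Suc i < n")
        case True
        hence "x (Suc i) = x 0 * v (Suc i)" using * by blast
        thus ?thesis unfolding bv[OF True, symmetric] using True by (simp only: if_True mult.left_commute)
      next
        case False
        hence "Suc i = n" using i by simp
        with * False show ?thesis by (metis divide_eq_0_iff mult_eq_0_iff)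
      qed
      hence "(if i = 0 then 0 else complex_of_real (c (i - 1)) * x (i - 1)) + complex_of_real (d i) * x i +
          (if Suc i < n then complex_of_real (b i) * x (Suc i) else 0) =
          x 0 * ((if i = 0 then 0 else complex_of_real (c (i - 1)) * v (i - 1)) +
            complex_of_real (d i) * v i + P (Suc i) / complex_of_real (\<Prod>j<i. b j))"
        unfolding xs by (simp only: distrib_left) simp
      also have "\<dots> = \<mu> * x i" unfolding v[OF i] xs by (rule mult.left_commute)
      finally show "(if i = 0 then 0 else complex_of_real (c (i - 1)) * x (i - 1)) +
          complex_of_real (d i) * x i +
          (if Suc i < n then complex_of_real (b i) * x (Suc i) else 0) = \<mu> * x i" .
    qed
  qed
qed


text \<open>Coordinate solutions are realised as Hilbert space vectors, so that eigenvectors of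
  different blocks and sectors lie in one space and their bases can be united.\<close>

definition tri_eigvecs :: "(nat \<Rightarrow> 'a::complex_hilbert) \<Rightarrow> (nat \<Rightarrow> real) \<Rightarrow> (nat \<Rightarrow> real) \<Rightarrow>
    (nat \<Rightarrow> real) \<Rightarrow> nat \<Rightarrow> complex \<Rightarrow> 'a set"
  where "tri_eigvecs f b c d n \<mu> = {\<Sum>i<n. scaleC (x i) (f i) | x. tri_eq b c d n \<mu> x}"

lemma sum_lessThan_add:
  fixes g :: "nat \<Rightarrow> 'a::comm_monoid_add"
  shows "sum g {..<k + m} = sum g {..<k} + (\<Sum>i<m. g (k + i))"
  by (induction m) (simp_all add: add.assoc)

text \<open>With both linking entries zero, the rows up to \<open>k\<close> and the rows after
  \<open>k\<close> have no unknown in common. Solutions restrict to the two blocks, and any two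
  block solutions can be concatenated.\<close>

lemma tri_eigvecs_split:
  fixes f :: "nat \<Rightarrow> 'a::complex_hilbert" and b c d :: "nat \<Rightarrow> real" and \<mu> :: complex and k m :: nat
  assumes bc: "b k = 0" "c k = 0" and m: "0 < m"
  defines "V1 \<equiv> tri_eigvecs f b c d (Suc k) \<mu>"
    and "V2 \<equiv> tri_eigvecs (\<lambda>i. f (Suc k + i)) (\<lambda>i. b (Suc k + i)) (\<lambda>i. c (Suc k + i))
      (\<lambda>i. d (Suc k + i)) m \<mu>"
  shows "tri_eigvecs f b c d (Suc k + m) \<mu> = {u + v | u v. u \<in> V1 \<and> v \<in> V2}"
proof -
  have eq: "tri_eq b c d (Suc k + m) \<mu> x \<longleftrightarrow> tri_eq b c d (Suc k) \<mu> x \<and>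
      tri_eq (\<lambda>i. b (Suc k + i)) (\<lambda>i. c (Suc k + i)) (\<lambda>i. d (Suc k + i)) m \<mu> (\<lambda>i. x (Suc k + i))"
    (is "?L = (?A \<and> ?B)") for x
  proof (intro iffI conjI)
    assume L: ?L
    show ?A
      unfolding tri_eq_def
    proof (intro allI impI)
      fix i assume i: "i < Suc k"
      with L[unfolded tri_eq_def, rule_format, of i] bc
      show "(if i = 0 then 0 else complex_of_real (c (i - 1)) * x (i - 1)) + complex_of_real (d i) * x i +
         (if Suc i < Suc k then complex_of_real (b i) * x (Suc i) else 0) = \<mu> * x i"
        using m by (cases "i = k") (simp_all cong: if_cong)
    qed
    show ?B
      unfolding tri_eq_def
    proof (intro allI impI)
      fix i assume i: "i < m"
      with L[unfolded tri_eq_def, rule_format, of "Suc k + i"] bc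
      show "(if i = 0 then 0 else complex_of_real (c (Suc k + (i - 1))) * x (Suc k + (i - 1))) +
         complex_of_real (d (Suc k + i)) * x (Suc k + i) +
         (if Suc i < m then complex_of_real (b (Suc k + i)) * x (Suc k + Suc i) else 0) = \<mu> * x (Suc k + i)"
        by (cases i) (simp_all cong: if_cong)
    qed
  next
    assume AB: "?A \<and> ?B"
    show ?L
      unfolding tri_eq_def
    proof (intro allI impI)
      fix i assume i: "i < Suc k + m"
      show "(if i = 0 then 0 else complex_of_real (c (i - 1)) * x (i - 1)) + complex_of_real (d i) * x i +
         (if Suc i < Suc k + m then complex_of_real (b i) * x (Suc i) else 0) = \<mu> * x i"
      proof (cases "i < Suc k")
        case True
        with AB[THEN conjunct1, unfolded tri_eq_def, rule_format, of i] bc m show ?thesis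
          by (cases "i = k") (simp_all cong: if_cong)
      next
        case False
        then obtain l where l: "i = Suc k + l" using le_Suc_ex linorder_not_le by blast
        with i AB[THEN conjunct2, unfolded tri_eq_def, rule_format, of l] bc show ?thesis
          by (cases l) (simp_all cong: if_cong)
      qed
    qed
  qed
  have glue: "tri_eq b c d (Suc k + m) \<mu> (\<lambda>i. if i < Suc k then y i else z (i - Suc k))"
    if y: "tri_eq b c d (Suc k) \<mu> y"
      and z: "tri_eq (\<lambda>i. b (Suc k + i)) (\<lambda>i. c (Suc k + i)) (\<lambda>i. d (Suc k + i)) m \<mu> z" for y z
    unfolding eq
  proof
    show "tri_eq b c d (Suc k) \<mu> (\<lambda>i. if i < Suc k then y i else z (i - Suc k))"
      unfolding tri_eq_def
    proof (intro allI impI)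
      fix i assume i: "i < Suc k"
      let ?x = "\<lambda>i. if i < Suc k then y i else z (i - Suc k)"
      have "?x i = y i" "?x (i - 1) = y (i - 1)" "Suc i < Suc k \<Longrightarrow> ?x (Suc i) = y (Suc i)"
        using i by auto
      with y[unfolded tri_eq_def, rule_format, OF i]
      show "(if i = 0 then 0 else complex_of_real (c (i - 1)) * ?x (i - 1)) + complex_of_real (d i) * ?x i +
         (if Suc i < Suc k then complex_of_real (b i) * ?x (Suc i) else 0) = \<mu> * ?x i"
        by presburger
    qed
    show "tri_eq (\<lambda>i. b (Suc k + i)) (\<lambda>i. c (Suc k + i)) (\<lambda>i. d (Suc k + i)) m \<mu>
        (\<lambda>i. if Suc k + i < Suc k then y (Suc k + i) else z (Suc k + i - Suc k))"
      using z by simp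
  qed
  show ?thesis
  proof (intro set_eqI iffI)
    fix u assume "u \<in> tri_eigvecs f b c d (Suc k + m) \<mu>"
    then obtain x where x: "tri_eq b c d (Suc k + m) \<mu> x" "u = (\<Sum>i<Suc k + m. scaleC (x i) (f i))"
      unfolding tri_eigvecs_def by blast
    have "u = (\<Sum>i<Suc k. scaleC (x i) (f i)) + (\<Sum>i<m. scaleC (x (Suc k + i)) (f (Suc k + i)))"
      unfolding x(2) by (rule sum_lessThan_add)
    moreover have "(\<Sum>i<Suc k. scaleC (x i) (f i)) \<in> V1"
      using x(1) unfolding eq V1_def tri_eigvecs_def by blast
    moreover have "(\<Sum>i<m. scaleC (x (Suc k + i)) (f (Suc k + i))) \<in> V2"
      using x(1) unfolding eq V2_def tri_eigvecs_def mem_Collect_eq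
      by (intro exI[of _ "\<lambda>i. x (Suc k + i)"] conjI refl) (rule conjunct2)
    ultimately show "u \<in> {u + v | u v. u \<in> V1 \<and> v \<in> V2}" by blast
  next
    fix u assume "u \<in> {u + v | u v. u \<in> V1 \<and> v \<in> V2}"
    then obtain u1 u2 where u12: "u = u1 + u2" "u1 \<in> V1" "u2 \<in> V2" by blast
    obtain y where y: "tri_eq b c d (Suc k) \<mu> y" "u1 = (\<Sum>i<Suc k. scaleC (y i) (f i))"
      using u12(2) unfolding V1_def tri_eigvecs_def by blast
    obtain z where z: "tri_eq (\<lambda>i. b (Suc k + i)) (\<lambda>i. c (Suc k + i)) (\<lambda>i. d (Suc k + i)) m \<mu> z"
        "u2 = (\<Sum>i<m. scaleC (z i) (f (Suc k + i)))"
      using u12(3) unfolding V2_def tri_eigvecs_def by blast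
    have "u = (\<Sum>i<Suc k + m. scaleC (if i < Suc k then y i else z (i - Suc k)) (f i))"
      unfolding u12(1) y(2) z(2) sum_lessThan_add by simp
    with glue[OF y(1) z(1)] show "u \<in> tri_eigvecs f b c d (Suc k + m) \<mu>"
      unfolding tri_eigvecs_def mem_Collect_eq
      by (intro exI[of _ "\<lambda>i. if i < Suc k then y i else z (i - Suc k)"] conjI)
  qed
qed

text \<open>Excluding 0 makes such sets linearly independent. Only cardinalities are counted later,
  so the vectors are not normalised.\<close>

definition orthogonal_set :: "'a::complex_hilbert set \<Rightarrow> bool" where
  "orthogonal_set B \<longleftrightarrow> 0 \<notin> B \<and> (\<forall>u\<in>B. \<forall>v\<in>B. u \<noteq> v \<longrightarrow> cinner u v = 0)"

lemma orthogonal_set_Un: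
  assumes "orthogonal_set A" "orthogonal_set B" "\<And>u v. u \<in> A \<Longrightarrow> v \<in> B \<Longrightarrow> cinner u v = 0"
  shows "orthogonal_set (A \<union> B)" "A \<inter> B = {}"
proof -
  have "cinner v u = 0" if "u \<in> A" "v \<in> B" for u v
    using assms(3)[OF that] cinner_commute[of v u] by simp
  thus "orthogonal_set (A \<union> B)" using assms unfolding orthogonal_set_def by blast
  show "A \<inter> B = {}"
  proof (rule equals0I)
    fix u assume "u \<in> A \<inter> B"
    hence "u = 0" "u \<in> A" using assms(3)[of u u] by simp_all
    thus False using assms(1) by (simp add: orthogonal_set_def)
  qed
qed

text \<open>Geometric and algebraic multiplicities agree: split the matrix at a vanishing off-diagonal entry
  until all blocks are irreducible, where both multiplicities are at most one.\<close>

lemma tri_eigvecs_orthogonal_basis: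
  assumes "\<And>i. i < n \<Longrightarrow> f i \<noteq> 0" "\<And>i j. i < n \<Longrightarrow> j < n \<Longrightarrow> i \<noteq> j \<Longrightarrow> cinner (f i) (f j) = 0"
    and "\<And>i. Suc i < n \<Longrightarrow> b i = 0 \<and> c i = 0 \<or> 0 < b i * c i"
  shows "\<exists>B. finite B \<and> card B = order \<mu> (jac d (\<lambda>i. b i * c i) n) \<and> orthogonal_set B \<and>
    B \<subseteq> tri_eigvecs f b c d n \<mu> \<and> tri_eigvecs f b c d n \<mu> \<subseteq> cvec.span B"
  using assms
proof (induction n arbitrary: f b c d rule: less_induct)
  case (less n)
  show ?case
  proof (cases "\<exists>k. Suc k < n \<and> b k = 0 \<and> c k = 0")
    case True
    then obtain k where k: "Suc k < n" "b k = 0" "c k = 0" by blast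
    obtain m where m: "n = Suc k + m" "0 < m" using k(1) less_imp_add_positive by blast
    let ?V1 = "tri_eigvecs f b c d (Suc k) \<mu>"
    let ?V2 = "tri_eigvecs (\<lambda>i. f (Suc k + i)) (\<lambda>i. b (Suc k + i)) (\<lambda>i. c (Suc k + i))
      (\<lambda>i. d (Suc k + i)) m \<mu>"
    obtain B1 where B1: "finite B1" "card B1 = order \<mu> (jac d (\<lambda>i. b i * c i) (Suc k))"
      "orthogonal_set B1" "B1 \<subseteq> ?V1" "?V1 \<subseteq> cvec.span B1"
      using less.IH[of "Suc k" f b c d] k less.prems by auto
    have "\<exists>B. finite B \<and> card B = order \<mu> (jac (\<lambda>i. d (Suc k + i)) (\<lambda>i. b (Suc k + i) * c (Suc k + i)) m) \<and>
        orthogonal_set B \<and> B \<subseteq> ?V2 \<and> ?V2 \<subseteq> cvec.span B"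
      by (rule less.IH) (use m less.prems in auto)
    then obtain B2 where B2: "finite B2"
      "card B2 = order \<mu> (jac (\<lambda>i. d (Suc k + i)) (\<lambda>i. b (Suc k + i) * c (Suc k + i)) m)"
      "orthogonal_set B2" "B2 \<subseteq> ?V2" "?V2 \<subseteq> cvec.span B2"
      by blast
    have orth: "cinner u v = 0" if uv: "u \<in> ?V1" "v \<in> ?V2" for u v
    proof -
      obtain y z where y: "u = (\<Sum>i<Suc k. scaleC (y i) (f i))"
        and z: "v = (\<Sum>i<m. scaleC (z i) (f (Suc k + i)))"
        using uv unfolding tri_eigvecs_def by blast
      have "cinner (f i) (f (Suc k + j)) = 0" if "i < Suc k" "j < m" for i j
        by (rule less.prems(2)) (use that m in auto)
      thus ?thesis unfolding y z
        by (simp only: cinner_sum_left cinner_sum_right cinner_scaleC_left cinner_scaleC_right)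
           (intro sum.neutral ballI, simp)
    qed
    note un = orthogonal_set_Un[OF B1(3) B2(3) orth[OF subsetD[OF B1(4)] subsetD[OF B2(4)]]]
    note V = tri_eigvecs_split[of b k c m f d \<mu>, OF k(2,3) m(2), folded m(1)]
    have zero: "0 \<in> ?V1" "0 \<in> ?V2"
      unfolding tri_eigvecs_def tri_eq_def by (auto intro!: exI[of _ "\<lambda>_. 0"])
    show ?thesis
    proof (intro exI[of _ "B1 \<union> B2"] conjI)
      \<comment> \<open>The order of a product of polynomials is additive, in step with the disjoint
        union of the bases.\<close>
      show "card (B1 \<union> B2) = order \<mu> (jac d (\<lambda>i. b i * c i) n)"
        unfolding m(1) using B1 B2 un(2) k
        by (subst jac_split) (simp_all add: card_Un_disjoint order_mult jac_nonzero)
      show "B1 \<union> B2 \<subseteq> tri_eigvecs f b c d n \<mu>"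
        unfolding V
      proof
        fix u assume "u \<in> B1 \<union> B2"
        thus "u \<in> {u + v |u v. u \<in> ?V1 \<and> v \<in> ?V2}"
        proof
          assume "u \<in> B1"
          hence "u \<in> ?V1" using B1(4) by blast
          moreover have "u = u + 0" by simp
          ultimately show ?thesis using zero(2) by blast
        next
          assume "u \<in> B2"
          hence "u \<in> ?V2" using B2(4) by blast
          moreover have "u = 0 + u" by simp
          ultimately show ?thesis using zero(1) by blast
        qed
      qed
      have "cvec.span B1 \<subseteq> cvec.span (B1 \<union> B2)" "cvec.span B2 \<subseteq> cvec.span (B1 \<union> B2)"
        by (rule cvec.span_mono; blast)+
      thus "tri_eigvecs f b c d n \<mu> \<subseteq> cvec.span (B1 \<union> B2)"
        unfolding V using B1(5) B2(5) by (auto intro!: cvec.span_add)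
    qed (use B1 B2 un in auto)
  next
    case False
    hence pos: "0 < b i * c i" if "Suc i < n" for i using less.prems(3)[OF that] that by blast
    show ?thesis
    proof (cases "n = 0")
      case True
      thus ?thesis
        by (intro exI[of _ "{}"]) (auto simp: tri_eigvecs_def orthogonal_set_def order_root)
    next
      case n: False
      define P where "P = (\<lambda>i. poly (jac d (\<lambda>i. b i * c i) i) \<mu>)"
      define v where "v = (\<lambda>i. P i / complex_of_real (\<Prod>j<i. b j))"
      have v0: "v 0 = 1" by (simp add: v_def P_def)
      have eq: "tri_eq b c d n \<mu> x \<longleftrightarrow> (\<forall>i<n. x i = x 0 * v i) \<and> (P n = 0 \<or> x 0 = 0)" for x
        unfolding v_def P_def by (rule tri_eq_irreducible) (use pos n in auto)
      let ?u = "\<Sum>i<n. scaleC (v i) (f i)"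
      have sub: "\<exists>a. u = scaleC a ?u \<and> (P n = 0 \<or> a = 0)" if "u \<in> tri_eigvecs f b c d n \<mu>" for u
      proof -
        obtain x where x: "tri_eq b c d n \<mu> x" "u = (\<Sum>i<n. scaleC (x i) (f i))"
          using \<open>u \<in> _\<close> unfolding tri_eigvecs_def by blast
        have xs: "x i = x 0 * v i" if "i < n" for i using x(1) that unfolding eq by blast
        have "u = (\<Sum>i<n. scaleC (x 0 * v i) (f i))"
          unfolding x(2) by (intro sum.cong refl arg_cong2[of _ _ _ _ scaleC] xs) auto
        also have "\<dots> = scaleC (x 0) ?u"
          by (simp only: cvec.scale_sum_right scaleC_scaleC)
        finally show ?thesis using x(1) unfolding eq by blast
      qed
      show ?thesis
      proof (cases "P n = 0")
        case True
        have "tri_eq b c d n \<mu> v" unfolding eq using True v0 by simp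
        hence u: "?u \<in> tri_eigvecs f b c d n \<mu>" unfolding tri_eigvecs_def by blast
        \<comment> \<open>Since \<open>v 0 = 1\<close>, the component along \<open>f 0\<close> shows
          that the candidate eigenvector is nonzero.\<close>
        have "cinner ?u (f 0) = (\<Sum>i<n. if i = 0 then cinner (f 0) (f 0) else 0)"
          unfolding cinner_sum_left cinner_scaleC_left
          by (intro sum.cong) (use less.prems(2) n v0 in auto)
        hence "cinner ?u (f 0) = cinner (f 0) (f 0)" using n by simp
        hence "?u \<noteq> 0" using less.prems(1)[of 0] n by auto
        moreover have "order \<mu> (jac d (\<lambda>i. b i * c i) n) = 1"
          by (rule jac_simple_root) (use pos True in \<open>auto simp: P_def\<close>)
        moreover have "tri_eigvecs f b c d n \<mu> \<subseteq> cvec.span {?u}"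
        proof
          fix u assume "u \<in> tri_eigvecs f b c d n \<mu>"
          then obtain a where "u = scaleC a ?u" using sub by blast
          thus "u \<in> cvec.span {?u}" by (simp only: cvec.span_scale cvec.span_base singletonI)
        qed
        ultimately show ?thesis
          using u by (intro exI[of _ "{?u}"]) (simp add: orthogonal_set_def)
      next
        case False
        have "tri_eigvecs f b c d n \<mu> \<subseteq> cvec.span {}"
        proof
          fix u assume "u \<in> tri_eigvecs f b c d n \<mu>"
          then obtain a where "u = scaleC a ?u" "P n = 0 \<or> a = 0" using sub by blast
          thus "u \<in> cvec.span {}" using False by simp
        qed
        moreover have "order \<mu> (jac d (\<lambda>i. b i * c i) n) = 0"
          using False by (simp add: P_def order_root)
        ultimately show ?thesis
          by (intro exI[of _ "{}"]) (simp add: orthogonal_set_def)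
      qed
    qed
  qed
qed

section \<open>The sectors\<close>

lemma D_poly_eq_jac:
  "D_poly w n m = jac (\<lambda>_. 0) (\<lambda>i. 1/4 * (w i)\<^sup>2 * (w (2 * n - (i + 2)))\<^sup>2) m"
  by (induction w n m rule: D_poly.induct) simp_all

lemma K_poly_eq_jac:
  "K_poly w n m = jac (\<lambda>_. 0) (\<lambda>i. 1/4 * (w i)\<^sup>2 * (w (2 * n - (i + 2) + 1))\<^sup>2) m"
  by (induction w n m rule: K_poly.induct) simp_all

text \<open>The sector of degree \<open>N\<close> is spanned by the \<open>E i j\<close> with \<open>i + j = N\<close>. Below, \<open>s\<close> is \<open>1\<close>
  for the symmetric and \<open>-1\<close> for the antisymmetric part.\<close>

definition sector_size :: "real \<Rightarrow> nat \<Rightarrow> nat" where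
  "sector_size s N = (if s = 1 then (N + 2) div 2 else (N + 1) div 2)"

text \<open>The coefficient that links positions \<open>i\<close> and \<open>i + 1\<close> of the
  antidiagonal of degree \<open>N\<close>. It is invariant under the reflection of \<open>i\<close>
  to \<open>N - 1 - i\<close>, which is what permits folding.\<close>

definition sector_upper :: "(nat \<Rightarrow> real) \<Rightarrow> nat \<Rightarrow> nat \<Rightarrow> real" where
  "sector_upper w N i = w i * w (N - 1 - i) / 2"

text \<open>The basis is not normalised, so the last entry is doubled for even \<open>N\<close> instead of both
  entries being multiplied by $\sqrt 2$.\<close>

definition sector_lower :: "(nat \<Rightarrow> real) \<Rightarrow> nat \<Rightarrow> nat \<Rightarrow> real" where
  "sector_lower w N i = (if 2 * Suc i = N then 2 else 1) * sector_upper w N i"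

text \<open>For odd \<open>N\<close> the fold passes between positions \<open>i\<close> and
  \<open>i + 1\<close> with \<open>2 * i + 1 = N\<close>. The flip equates the latter with
  \<open>s\<close> times the former, so the linking entry moves onto the diagonal.\<close>

definition sector_diag :: "real \<Rightarrow> (nat \<Rightarrow> real) \<Rightarrow> nat \<Rightarrow> nat \<Rightarrow> real" where
  "sector_diag s w N i = (if Suc (2 * i) = N then s * sector_upper w N i else 0)"

definition sector_poly :: "real \<Rightarrow> (nat \<Rightarrow> real) \<Rightarrow> nat \<Rightarrow> complex poly" where
  "sector_poly s w N =
    jac (sector_diag s w N) (\<lambda>i. sector_upper w N i * sector_lower w N i) (sector_size s N)"

lemma sector_poly_odd:
  assumes "n \<ge> 1" "s = 1 \<or> s = - 1"
  shows "sector_poly s w (2 * n - 1) = C_poly s w n"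
proof -
  obtain m where n: "n = Suc m" using assms(1) by (cases n) auto
  have size: "sector_size s (2 * n - 1) = Suc m"
    using assms(2) n by (auto simp: sector_size_def)
  let ?d = "sector_diag s w (2 * n - 1)"
  let ?\<beta> = "\<lambda>i. sector_upper w (2 * n - 1) i * sector_lower w (2 * n - 1) i"
  have 1: "jac ?d ?\<beta> k = D_poly w n k" if "k \<le> m" for k
    unfolding D_poly_eq_jac
  proof (rule jac_cong)
    show "?d i = 0" if "i < k" for i using that \<open>k \<le> m\<close> n by (simp add: sector_diag_def)
    \<comment> \<open>Parity rules out the doubled entry of \<open>sector_lower\<close>.\<close>
    have "odd (2 * n - 1)" using n by simp
    hence "2 * Suc i \<noteq> 2 * n - 1" for i by presburger
    thus "?\<beta> i = 1/4 * (w i)\<^sup>2 * (w (2 * n - (i + 2)))\<^sup>2" if "Suc i < k" for i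
      by (simp add: sector_upper_def sector_lower_def power2_eq_square)
  qed
  have \<beta>: "?\<beta> (m - 1) = 1/4 * (w (n - 2))\<^sup>2 * (w n)\<^sup>2" if "m \<noteq> 0"
  proof -
    have "2 * n - 1 - 1 - (m - 1) = n" "m - 1 = n - 2" "2 * Suc (m - 1) \<noteq> 2 * n - 1" using n that by auto
    thus ?thesis by (simp add: sector_upper_def sector_lower_def power2_eq_square)
  qed
  have d: "?d m = s * (1/2) * (w (n - 1))\<^sup>2"
    using n by (simp add: sector_diag_def sector_upper_def power2_eq_square)
  have "sector_poly s w (2 * n - 1) = [:- complex_of_real (?d m), 1:] * D_poly w n m -
      (if m = 0 then 0 else smult (complex_of_real (?\<beta> (m - 1))) (D_poly w n (m - 1)))"
    unfolding sector_poly_def size jac_Suc by (simp only: 1[OF order_refl] 1[OF diff_le_self])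
  also have "(if m = 0 then 0 else smult (complex_of_real (?\<beta> (m - 1))) (D_poly w n (m - 1))) =
      (if n = 1 then 0 else smult (complex_of_real (1/4 * (w (n - 2))\<^sup>2 * (w n)\<^sup>2)) (D_poly w n (n - 2)))"
  proof (cases "m = 0")
    case False
    hence "m - 1 = n - 2" "n \<noteq> 1" using n by auto
    thus ?thesis using False \<beta>[OF False] by (simp only: if_False)
  qed (simp add: n)
  also have "m = n - 1" using n by simp
  finally show ?thesis unfolding C_poly_def d[unfolded \<open>m = n - 1\<close>] .
qed

text \<open>The doubled entry is the one at \<open>n - 1\<close>, which the bound on
  \<open>i\<close> excludes.\<close>

lemma sector_even_entries:
  assumes "Suc i < n"
  shows "sector_upper w (2 * n) i * sector_lower w (2 * n) i =
    1/4 * (w i)\<^sup>2 * (w (2 * n - (i + 2) + 1))\<^sup>2"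
proof -
  have "2 * n - 1 - i = 2 * n - (i + 2) + 1" "2 * Suc i \<noteq> 2 * n" using assms by (linarith, simp)
  thus ?thesis by (simp add: sector_upper_def sector_lower_def power2_eq_square)
qed

lemma sector_poly_even_plus:
  assumes "n \<ge> 1"
  shows "sector_poly 1 w (2 * n) = G_plus w n"
proof -
  let ?d = "sector_diag 1 w (2 * n)"
  let ?\<beta> = "\<lambda>i. sector_upper w (2 * n) i * sector_lower w (2 * n) i"
  have "Suc (2 * i) \<noteq> 2 * n" for i by presburger
  hence d: "?d i = 0" for i by (simp add: sector_diag_def)
  have 1: "jac ?d ?\<beta> k = K_poly w n k" if "k \<le> n" for k
    unfolding K_poly_eq_jac
    by (rule jac_cong) (use that in \<open>simp_all add: d sector_even_entries\<close>)
  \<comment> \<open>Here the doubled entry turns the usual factor 1/4 into the 1/2 in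
    \<open>G_plus\<close>.\<close>
  have "2 * n - 1 - (n - 1) = n" "2 * Suc (n - 1) = 2 * n" using assms by auto
  hence \<beta>: "?\<beta> (n - 1) = 1/2 * (w (n - 1))\<^sup>2 * (w n)\<^sup>2"
    by (simp add: sector_upper_def sector_lower_def power2_eq_square)
  have size: "sector_size 1 (2 * n) = Suc n" by (simp add: sector_size_def)
  have "n \<noteq> 0" using assms by simp
  thus ?thesis
    unfolding sector_poly_def size G_plus_def jac_Suc 1[OF order_refl] 1[OF diff_le_self] \<beta> d
    by (simp only: if_False) simp
qed

text \<open>Antisymmetry removes the middle position, so the matrix has \<open>n\<close> rows and
  the doubled entry lies outside it.\<close>

lemma sector_poly_even_minus: "sector_poly (- 1) w (2 * n) = G_minus w n"
proof -
  have "Suc (2 * i) \<noteq> 2 * n" for i by presburger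
  hence "sector_diag (- 1) w (2 * n) i = 0" for i by (simp add: sector_diag_def)
  thus ?thesis
    unfolding sector_poly_def G_minus_def K_poly_eq_jac
    by (intro trans[OF jac_cong arg_cong[of _ _ "jac _ _"]])
       (simp_all add: sector_size_def sector_even_entries)
qed

text \<open>The matrix of this sector is the one-by-one zero matrix; it accounts for the adjoined
  copy of 0.\<close>

lemma order_sector_poly_0:
  "order \<mu> (sector_poly 1 w 0) = (if \<mu> = 0 then 1 else 0)"
proof -
  have eq: "sector_poly 1 w 0 = [:- 0, 1:]"
    by (simp add: sector_poly_def sector_size_def sector_diag_def)
  show ?thesis
  proof (cases "\<mu> = 0")
    case True
    thus ?thesis unfolding eq using order_power_n_n[of "0::complex" 1] by simp
  next
    case False
    thus ?thesis unfolding eq by (simp add: order_0I)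
  qed
qed

text \<open>The right-hand side of \<open>coef_tensor_shift\<close> for an arbitrary array of
  numbers, so that folding becomes a computation outside the tensor space.\<close>

definition sector_action :: "(nat \<Rightarrow> real) \<Rightarrow> (nat \<Rightarrow> nat \<Rightarrow> complex) \<Rightarrow> nat \<Rightarrow> nat \<Rightarrow> complex" where
  "sector_action w y k l =
    (if k = 0 then 0 else complex_of_real (w (k - 1) * w l / 2) * y (k - 1) (Suc l)) +
    (if l = 0 then 0 else complex_of_real (w k * w (l - 1) / 2) * y (Suc k) (l - 1))"

text \<open>Only in the last row does the neighbour \<open>i + 1\<close> lie beyond the fold. The
  flip expresses its value as \<open>s * X i\<close> for odd \<open>N\<close>; for even
  \<open>N\<close> it is \<open>X (i - 1)\<close> if \<open>s = 1\<close>, which doubles the lower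
  entry, and 0 if \<open>s = -1\<close>, being a diagonal value of an antisymmetric array.\<close>

lemma sector_action_eq_tri:
  assumes s: "s = 1 \<or> s = - 1" and sym: "\<And>k l. y l k = complex_of_real s * y k l"
    and i: "i < sector_size s N"
  defines "X \<equiv> \<lambda>i. y i (N - i)"
  shows "sector_action w y i (N - i) =
    (if i = 0 then 0 else complex_of_real (sector_lower w N (i - 1)) * X (i - 1)) +
    complex_of_real (sector_diag s w N i) * X i +
    (if Suc i < sector_size s N then complex_of_real (sector_upper w N i) * X (Suc i) else 0)"
proof -
  have iN: "i \<le> N" using i s by (auto simp: sector_size_def split: if_splits)
  define a where "a = complex_of_real (sector_upper w N i)"
  define a' where "a' = complex_of_real (sector_upper w N (i - 1))"
  have up: "(if i = 0 then 0 else complex_of_real (w (i - 1) * w (N - i) / 2) * y (i - 1) (Suc (N - i))) =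
      (if i = 0 then 0 else a' * X (i - 1))"
    using iN by (auto simp: X_def a'_def sector_upper_def Suc_diff_le)
  have down: "(if N - i = 0 then 0 else complex_of_real (w i * w (N - i - 1) / 2) * y (Suc i) (N - i - 1)) =
      (if i = N then 0 else a * X (Suc i))"
    using iN by (auto simp: X_def a_def sector_upper_def)
  have act: "sector_action w y i (N - i) = (if i = 0 then 0 else a' * X (i - 1)) + (if i = N then 0 else a * X (Suc i))"
    unfolding sector_action_def up down ..
  consider (inner) "Suc i < sector_size s N" | (odd) "N = Suc (2 * i)" "Suc i = sector_size s N"
    | (plus) "N = 2 * i" "s = 1" "Suc i = sector_size s N"
    | (minus) "N = 2 * Suc i" "s = - 1" "Suc i = sector_size s N"
  proof (cases "Suc i < sector_size s N")
    case False
    hence eq: "Suc i = sector_size s N" using i by simp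
    from s show ?thesis
    proof
      assume "s = 1"
      hence "(N + 2) div 2 = Suc i" using eq by (simp add: sector_size_def)
      hence "N = Suc (2 * i) \<or> N = 2 * i" by presburger
      thus ?thesis using eq \<open>s = 1\<close> that by blast
    next
      assume "s = - 1"
      hence "(N + 1) div 2 = Suc i" using eq by (simp add: sector_size_def)
      hence "N = Suc (2 * i) \<or> N = 2 * Suc i" by presburger
      thus ?thesis using eq \<open>s = - 1\<close> that by blast
    qed
  qed (rule that)
  thus ?thesis
  proof cases
    case inner
    hence "i < N" "i = 0 \<or> 2 * Suc (i - 1) \<noteq> N" "Suc (2 * i) \<noteq> N" using s
      by (auto simp: sector_size_def split: if_splits)
    thus ?thesis using inner unfolding act by (auto simp: a_def a'_def sector_lower_def sector_diag_def)
  next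
    case odd
    have "X (Suc i) = complex_of_real s * X i"
      using sym[of "Suc i" i] odd(1) by (simp add: X_def)
    thus ?thesis using odd unfolding act
      by (auto simp: a_def a'_def sector_lower_def sector_diag_def)
  next
    case plus
    \<comment> \<open>The guard covers \<open>N = 0\<close>, where the single position has no
      neighbours.\<close>
    have "i \<noteq> 0 \<Longrightarrow> X (Suc i) = X (i - 1)"
      using sym[of "Suc i" "i - 1"] plus(1,2) by (simp add: X_def)
    moreover have "i \<noteq> 0 \<Longrightarrow> a = a'"
      using plus(1) by (simp add: a_def a'_def sector_upper_def)
    moreover have "i \<noteq> 0 \<Longrightarrow> complex_of_real (sector_lower w N (i - 1)) = 2 * a'"
      using plus(1) by (simp add: a'_def sector_lower_def)
    ultimately show ?thesis using plus unfolding act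
      by (auto simp: sector_diag_def)
  next
    case minus
    have "X (Suc i) = 0"
      using sym[of "Suc i" "Suc i"] minus(1,2) by (simp add: X_def)
    moreover have "i \<noteq> N" "Suc (2 * i) \<noteq> N" "i = 0 \<or> 2 * Suc (i - 1) \<noteq> N"
      using minus(1) by auto
    moreover have "\<not> Suc i < sector_size s N"
      using minus(3) by linarith
    ultimately show ?thesis unfolding act
      by (auto simp: a_def a'_def sector_lower_def sector_diag_def)
  qed
qed

text \<open>The action commutes with the flip, so the equations beyond the fold repeat those before
  it. For \<open>s = -1\<close> there remains the position \<open>k = l\<close>, where both sides
  vanish.\<close>

lemma sector_eigen_iff:
  assumes s: "s = 1 \<or> s = - 1" and sym: "\<And>k l. y l k = complex_of_real s * y k l"
  shows "(\<forall>k l. k + l = N \<longrightarrow> sector_action w y k l = \<mu> * y k l) \<longleftrightarrow>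
    tri_eq (sector_upper w N) (sector_lower w N) (sector_diag s w N) (sector_size s N) \<mu> (\<lambda>i. y i (N - i))"
proof
  assume L: "\<forall>k l. k + l = N \<longrightarrow> sector_action w y k l = \<mu> * y k l"
  show "tri_eq (sector_upper w N) (sector_lower w N) (sector_diag s w N) (sector_size s N) \<mu> (\<lambda>i. y i (N - i))"
    unfolding tri_eq_def
  proof (intro allI impI)
    fix i assume i: "i < sector_size s N"
    hence "i + (N - i) = N" using s by (auto simp: sector_size_def split: if_splits)
    with L have "sector_action w y i (N - i) = \<mu> * y i (N - i)" by blast
    thus "(if i = 0 then 0 else complex_of_real (sector_lower w N (i - 1)) * y (i - 1) (N - (i - 1))) +
      complex_of_real (sector_diag s w N i) * y i (N - i) +
      (if Suc i < sector_size s N then complex_of_real (sector_upper w N i) * y (Suc i) (N - Suc i) else 0) =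
      \<mu> * y i (N - i)"
      unfolding sector_action_eq_tri[OF s sym i] .
  qed
next
  assume R: "tri_eq (sector_upper w N) (sector_lower w N) (sector_diag s w N) (sector_size s N) \<mu> (\<lambda>i. y i (N - i))"
  have 1: "sector_action w y k l = \<mu> * y k l" if "k < sector_size s N" "k + l = N" for k l
  proof -
    have l: "l = N - k" using that by simp
    show ?thesis
      unfolding l sector_action_eq_tri[OF s sym that(1)]
      by (rule R[unfolded tri_eq_def, rule_format, OF that(1)])
  qed
  have flip: "sector_action w y l k = complex_of_real s * sector_action w y k l" for k l
    unfolding sector_action_def
    by (subst (1 2) sym) (simp add: algebra_simps)
  show "\<forall>k l. k + l = N \<longrightarrow> sector_action w y k l = \<mu> * y k l"
  proof (intro allI impI)
    fix k l assume kl: "k + l = N"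
    consider "k < sector_size s N" | "l < sector_size s N" | "k = l" "s = - 1"
      using kl s by (fastforce simp: sector_size_def split: if_splits)
    thus "sector_action w y k l = \<mu> * y k l"
    proof cases
      case 2
      have "sector_action w y k l = complex_of_real s * sector_action w y l k" by (rule flip)
      also have "\<dots> = \<mu> * y k l"
        using 1[OF 2] kl sym[of k l] by (simp add: add.commute)
      finally show ?thesis .
    next
      case 3
      thus ?thesis using flip[of k k] sym[of k k] by simp
    qed (rule 1[OF _ kl])
  qed
qed

section \<open>The point spectrum\<close>

lemma orthogonal_set_independent:
  assumes "orthogonal_set B"
  shows "\<not> cvec.dependent B"
  unfolding cvec.independent_explicit_module
proof (intro allI impI)
  fix t u v assume t: "finite t" "t \<subseteq> B" "(\<Sum>v\<in>t. scaleC (u v) v) = 0" "v \<in> t"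
  have "0 = cinner (\<Sum>x\<in>t. scaleC (u x) x) v" by (simp add: t(3))
  also have "\<dots> = (\<Sum>x\<in>t. if x = v then u v * cinner v v else 0)"
    unfolding cinner_sum_left cinner_scaleC_left
    by (intro sum.cong) (use assms t in \<open>auto simp: orthogonal_set_def\<close>)
  also have "\<dots> = u v * cinner v v" using t by simp
  finally show "u v = 0" using assms t by (auto simp: orthogonal_set_def)
qed

text \<open>Spanning is demanded for finite \<open>B\<close>. An infinite independent subset already
  forces infinite dimension, and in that case \<open>V\<close> may contain limits outside the
  algebraic span of \<open>B\<close>.\<close>

lemma cdimension_orthogonal_basis:
  assumes "orthogonal_set B" "B \<subseteq> V" "finite B \<Longrightarrow> V \<subseteq> cvec.span B"
  shows "cdimension V = ecard B"
proof -
  note ind = orthogonal_set_independent[OF assms(1)]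
  show ?thesis
  proof (cases "finite B")
    case True
    from assms(3)[OF this] True cvec.basis_card_eq_dim[OF assms(2) _ ind] show ?thesis
      unfolding cdimension_def ecard_def by auto
  next
    case False
    have "\<not> (\<exists>F. finite F \<and> V \<subseteq> cvec.span F)"
    proof
      assume "\<exists>F. finite F \<and> V \<subseteq> cvec.span F"
      then obtain F where F: "finite F" "V \<subseteq> cvec.span F" by blast
      from cvec.independent_span_bound[OF F(1) ind order_trans[OF assms(2) F(2)]] False
      show False by blast
    qed
    thus ?thesis using False by (simp add: cdimension_def ecard_def)
  qed
qed

text \<open>Used to match eigenvectors with roots sector by sector: the bijections between the
  finite pieces glue to one between the unions, which may be infinite.\<close>

lemma ecard_UN_eq:
  assumes "\<And>N. finite (A N)" "\<And>N. finite (B N)" "\<And>N. card (A N) = card (B N)"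
    and "\<And>M N. M \<noteq> N \<Longrightarrow> A M \<inter> A N = {}" "\<And>M N. M \<noteq> N \<Longrightarrow> B M \<inter> B N = {}"
  shows "ecard (\<Union>N\<in>I. A N) = ecard (\<Union>N\<in>I. B N)"
proof -
  obtain f where f: "\<And>N. bij_betw (f N) (A N) (B N)"
    using finite_same_card_bij[OF assms(1,2,3)] by metis
  define g where "g x = f (THE N. x \<in> A N) x" for x
  have the: "(THE M. x \<in> A M) = N" if "x \<in> A N" for x N
    using that assms(4) by blast
  have "bij_betw g (A N) (B N)" for N
    using f[of N] by (rule bij_betw_cong[THEN iffD1, rotated]) (simp add: g_def the)
  hence "bij_betw g (\<Union>N\<in>I. A N) (\<Union>N\<in>I. B N)"
    by (intro bij_betw_UNION_disjoint) (auto simp: disjoint_family_on_def assms(5))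
  thus ?thesis
    unfolding ecard_def using bij_betw_finite bij_betw_same_card by metis
qed

lemma ecard_Un_disjoint: "A \<inter> B = {} \<Longrightarrow> ecard (A \<union> B) = ecard A + ecard B"
  by (auto simp: ecard_def card_Un_disjoint)

section \<open>Eigenspaces of the two operators and their decomposition into sectors\<close>

context hardy_tensor
begin

text \<open>Coordinate form of both eigenspaces, with the sign as a parameter so that one argument
  serves the symmetric and the antisymmetric operator.\<close>

definition eigvecs :: "(nat \<Rightarrow> real) \<Rightarrow> real \<Rightarrow> complex \<Rightarrow> 't set" where
  "eigvecs w s \<mu> = {x. (\<forall>k l. coef x l k = complex_of_real s * coef x k l) \<and>
    (\<forall>k l. sector_action w (coef x) k l = \<mu> * coef x k l)}"

lemma coef_eq_iff: "x = y \<longleftrightarrow> (\<forall>i j. coef x i j = coef y i j)"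
  using coef_eqI[of x y] by auto

lemma point_spectrum_eq:
  assumes "bounded (range w)"
  defines "S \<equiv> weighted_shift w"
  shows "point_spectrum (sym_space tns) (sym_op tns S (adjoint_op S)) \<mu> = cdimension (eigvecs w 1 \<mu>)"
    and "point_spectrum (antisym_space tns) (antisym_op tns S (adjoint_op S)) \<mu> = cdimension (eigvecs w (- 1) \<mu>)"
proof -
  have T: "scaleC (1/2) (tensor_op tns S (adjoint_op S) x + tensor_op tns (adjoint_op S) S x) = scaleC \<mu> x \<longleftrightarrow>
      (\<forall>k l. sector_action w (coef x) k l = \<mu> * coef x k l)" for x
  proof -
    have "coef (scaleC (1/2) (tensor_op tns S (adjoint_op S) x + tensor_op tns (adjoint_op S) S x)) k l =
        sector_action w (coef x) k l" for k l
      unfolding S_def sector_action_def by (rule coef_tensor_shift[OF assms(1)])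
    thus ?thesis by (simp only: coef_eq_iff coef_linear(2))
  qed
  have flip: "flip_op tns x = x \<longleftrightarrow> (\<forall>k l. coef x l k = complex_of_real 1 * coef x k l)" for x
    by (simp add: coef_eq_iff[of "flip_op tns x"] coef_flip_op)
  have flip': "flip_op tns x = - x \<longleftrightarrow> (\<forall>k l. coef x l k = complex_of_real (- 1) * coef x k l)" for x
    by (simp add: coef_eq_iff[of "flip_op tns x"] coef_flip_op coef_linear(4))
  have mem: "x \<in> sym_space tns \<longleftrightarrow> (\<forall>k l. coef x l k = complex_of_real 1 * coef x k l)" for x
    unfolding sym_space_def mem_Collect_eq by (rule flip)
  have "{x \<in> sym_space tns. sym_op tns S (adjoint_op S) x = scaleC \<mu> x} = eigvecs w 1 \<mu>"
    unfolding eigvecs_def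
  proof (intro Collect_cong conj_cong mem)
    fix x assume "\<forall>k l. coef x l k = complex_of_real 1 * coef x k l"
    from mem[THEN iffD2, OF this]
    show "sym_op tns S (adjoint_op S) x = scaleC \<mu> x \<longleftrightarrow>
        (\<forall>k l. sector_action w (coef x) k l = \<mu> * coef x k l)"
      by (simp only: sym_op_def restrict_apply if_True T)
  qed
  thus "point_spectrum (sym_space tns) (sym_op tns S (adjoint_op S)) \<mu> = cdimension (eigvecs w 1 \<mu>)"
    by (simp only: point_spectrum_def)
  have mem: "x \<in> antisym_space tns \<longleftrightarrow> (\<forall>k l. coef x l k = complex_of_real (- 1) * coef x k l)" for x
    unfolding antisym_space_def mem_Collect_eq by (rule flip')
  have "{x \<in> antisym_space tns. antisym_op tns S (adjoint_op S) x = scaleC \<mu> x} = eigvecs w (- 1) \<mu>"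
    unfolding eigvecs_def
  proof (intro Collect_cong conj_cong mem)
    fix x assume "\<forall>k l. coef x l k = complex_of_real (- 1) * coef x k l"
    from mem[THEN iffD2, OF this]
    show "antisym_op tns S (adjoint_op S) x = scaleC \<mu> x \<longleftrightarrow>
        (\<forall>k l. sector_action w (coef x) k l = \<mu> * coef x k l)"
      by (simp only: antisym_op_def restrict_apply if_True T)
  qed
  thus "point_spectrum (antisym_space tns) (antisym_op tns S (adjoint_op S)) \<mu> = cdimension (eigvecs w (- 1) \<mu>)"
    by (simp only: point_spectrum_def)
qed

text \<open>Used for \<open>i < sector_size s N\<close>, where \<open>i\<close> is the smaller
  index. The middle case \<open>2 * i = N\<close> then arises for \<open>s = 1\<close>
  alone.\<close>

definition sector_vec :: "real \<Rightarrow> nat \<Rightarrow> nat \<Rightarrow> 't" where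
  "sector_vec s N i =
    (if 2 * i = N then E i i else E i (N - i) + scaleC (complex_of_real s) (E (N - i) i))"

lemma sector_size_bound:
  assumes "s = 1 \<or> s = - 1" "i < sector_size s N"
  shows "2 * i \<le> N" "i \<le> N"
  using assms by (auto simp: sector_size_def split: if_splits)

lemma coef_sector_vec:
  assumes "2 * i \<le> N"
  shows "coef (sector_vec s N i) k l = (if k + l = N then
    if k = i then 1 else if l = i then complex_of_real s else 0 else 0)"
proof (cases "2 * i = N")
  case True
  show ?thesis unfolding sector_vec_def using True by (auto simp: coef_E)
next
  case False
  have 1: "i = k \<and> N - i = l \<longleftrightarrow> k + l = N \<and> k = i" "N - i = k \<and> i = l \<longleftrightarrow> k + l = N \<and> l = i"
    using assms by linarith+
  have 2: "\<not> (k + l = N \<and> k = i \<and> l = i)" using False by linarith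
  show ?thesis using False 2 unfolding sector_vec_def by (simp add: coef_linear coef_E 1)
qed

lemma coef_sum_sector_vec:
  assumes s: "s = 1 \<or> s = - 1"
  shows "coef (\<Sum>i<sector_size s N. scaleC (x i) (sector_vec s N i)) k l = (if k + l = N then
    if k < sector_size s N then x k else if l < sector_size s N then complex_of_real s * x l else 0 else 0)"
proof -
  let ?n = "sector_size s N"
  have "coef (\<Sum>i<?n. scaleC (x i) (sector_vec s N i)) k l =
      (\<Sum>i<?n. if k + l = N then if k = i then x i else if l = i then complex_of_real s * x i else 0 else 0)"
    unfolding coef_linear
    by (intro sum.cong refl)
       (use sector_size_bound[OF s] in \<open>auto simp: coef_sector_vec\<close>)
  also have "\<dots> = (if k + l = N then
    if k < ?n then x k else if l < ?n then complex_of_real s * x l else 0 else 0)"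
  proof (cases "k + l = N \<and> k < ?n")
    case True
    \<comment> \<open>Two indices below the sector size add up to \<open>N\<close> only if they
      coincide, so the branch \<open>l = i\<close> contributes nothing here.\<close>
    have "(if k = i then x i else if l = i then complex_of_real s * x i else 0) = (if k = i then x i else 0)"
      if "i < ?n" for i
      using sector_size_bound(1)[OF s that] sector_size_bound(1)[OF s conjunct2[OF True]] conjunct1[OF True]
      by auto
    hence "(\<Sum>i<?n. if k = i then x i else if l = i then complex_of_real s * x i else 0) =
        (\<Sum>i<?n. if k = i then x i else 0)" by (intro sum.cong) auto
    thus ?thesis using True by simp
  next
    case False
    hence "k + l = N \<Longrightarrow> (\<Sum>i<?n. if k = i then x i else if l = i then complex_of_real s * x i else 0) =
        (\<Sum>i<?n. if l = i then complex_of_real s * x i else 0)" by (intro sum.cong) auto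
    thus ?thesis using False by auto
  qed
  finally show ?thesis .
qed

lemma cinner_sector_vec:
  assumes s: "s = 1 \<or> s = - 1" and ij: "i < sector_size s N" "j < sector_size s N" "i \<noteq> j"
  shows "cinner (sector_vec s N i) (sector_vec s N j) = 0"
proof -
  have "i + j \<noteq> N" using sector_size_bound[OF s ij(1)] sector_size_bound[OF s ij(2)] ij(3) by linarith
  hence "N - j \<noteq> i" using sector_size_bound(2)[OF s ij(2)] by linarith
  hence 0: "coef (sector_vec s N i) j (N - j) = 0" "coef (sector_vec s N i) (N - j) j = 0"
    using ij(3) by (simp_all add: coef_sector_vec[OF sector_size_bound(1)[OF s ij(1)]])
  show ?thesis
  proof (cases "2 * j = N")
    case True
    hence "sector_vec s N j = E j (N - j)" by (auto simp: sector_vec_def)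
    thus ?thesis using 0(1) by (simp only: coef_def)
  next
    case False
    hence "sector_vec s N j = E j (N - j) + scaleC (complex_of_real s) (E (N - j) j)"
      by (simp add: sector_vec_def)
    thus ?thesis using 0 by (simp add: cinner_add_right cinner_scaleC_right coef_def)
  qed
qed

text \<open>The folded matrix supplies the basis, by both directions of
  \<open>sector_eigen_iff\<close>. The last clause says that the component in sector
  \<open>N\<close> of any eigenvector lies in the span of \<open>B\<close>; stating it by
  coefficients replaces an orthogonal projection.\<close>

lemma sector_basis:
  assumes w: "\<And>i. 0 \<le> w i" and s: "s = 1 \<or> s = - 1"
  shows "\<exists>B. finite B \<and> card B = order \<mu> (sector_poly s w N) \<and> orthogonal_set B \<and> B \<subseteq> eigvecs w s \<mu> \<and>
    (\<forall>x\<in>B. \<forall>k l. k + l \<noteq> N \<longrightarrow> coef x k l = 0) \<and>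
    (\<forall>x\<in>eigvecs w s \<mu>. \<exists>y\<in>cvec.span B. \<forall>k l. coef y k l = (if k + l = N then coef x k l else 0))"
proof -
  let ?n = "sector_size s N"
  let ?V = "tri_eigvecs (sector_vec s N) (sector_upper w N) (sector_lower w N) (sector_diag s w N) ?n \<mu>"
  have up: "0 \<le> sector_upper w N i" for i by (simp add: sector_upper_def w)
  have "\<exists>B. finite B \<and> card B = order \<mu> (sector_poly s w N) \<and> orthogonal_set B \<and>
    B \<subseteq> ?V \<and> ?V \<subseteq> cvec.span B"
    unfolding sector_poly_def
  proof (rule tri_eigvecs_orthogonal_basis)
    fix i assume i: "i < ?n"
    have "coef (sector_vec s N i) i (N - i) = 1"
      using sector_size_bound[OF s i] by (simp add: coef_sector_vec)
    thus "sector_vec s N i \<noteq> 0" by (auto simp: coef_linear)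
  next
    \<comment> \<open>Both entries are nonnegative and differ by a factor 1 or 2, so they vanish
      together.\<close>
    show "sector_upper w N i = 0 \<and> sector_lower w N i = 0 \<or> 0 < sector_upper w N i * sector_lower w N i" for i
      using up[of i] by (auto simp: sector_lower_def)
  qed (rule cinner_sector_vec[OF s])
  then obtain B where B: "finite B" "card B = order \<mu> (sector_poly s w N)" "orthogonal_set B"
    "B \<subseteq> ?V" "?V \<subseteq> cvec.span B" by blast
  have hom: "coef x k l = 0" if x: "x \<in> ?V" and kl: "k + l \<noteq> N" for x k l
    using x kl unfolding tri_eigvecs_def by (auto simp: coef_sum_sector_vec[OF s])
  have "x \<in> eigvecs w s \<mu>" if V: "x \<in> ?V" for x
  proof -
    obtain y where y: "tri_eq (sector_upper w N) (sector_lower w N) (sector_diag s w N) ?n \<mu> y"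
      and xy: "x = (\<Sum>i<?n. scaleC (y i) (sector_vec s N i))"
      using V unfolding tri_eigvecs_def by blast
    note c = coef_sum_sector_vec[OF s, where N = N and x = y, folded xy]
    have sym: "coef x l k = complex_of_real s * coef x k l" for k l
    proof -
      have "complex_of_real s * complex_of_real s = 1" using s by auto
      hence "complex_of_real s * (complex_of_real s * a) = a" for a by (simp flip: mult.assoc)
      moreover have "k = l \<and> s = 1" if "k < ?n" "l < ?n" "k + l = N"
        using that s by (auto simp: sector_size_def split: if_splits)
      ultimately show ?thesis unfolding c by (auto simp: add.commute)
    qed
    have "tri_eq (sector_upper w N) (sector_lower w N) (sector_diag s w N) ?n \<mu> (\<lambda>i. coef x i (N - i))"
      by (rule tri_eq_cong[THEN iffD1, OF _ y]) (use sector_size_bound(2)[OF s] in \<open>simp add: c\<close>)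
    from sector_eigen_iff[OF s, of "coef x", THEN iffD2, OF sym this]
    have "sector_action w (coef x) k l = \<mu> * coef x k l" if "k + l = N" for k l
      using that by blast
    \<comment> \<open>Outside the sector both sides are 0, because the action stays on one
      antidiagonal.\<close>
    moreover have "sector_action w (coef x) k l = \<mu> * coef x k l" if "k + l \<noteq> N" for k l
      unfolding sector_action_def using that by (auto simp: hom[OF V])
    ultimately show ?thesis unfolding eigvecs_def using sym by blast
  qed
  hence sub: "B \<subseteq> eigvecs w s \<mu>" using B(4) by blast
  have proj: "\<exists>y\<in>cvec.span B. \<forall>k l. coef y k l = (if k + l = N then coef x k l else 0)"
    if x: "x \<in> eigvecs w s \<mu>" for x
  proof
    have sym: "coef x l k = complex_of_real s * coef x k l" for k l
      using x unfolding eigvecs_def by blast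
    let ?y = "\<Sum>i<?n. scaleC (coef x i (N - i)) (sector_vec s N i)"
    have "\<forall>k l. k + l = N \<longrightarrow> sector_action w (coef x) k l = \<mu> * coef x k l"
      using x unfolding eigvecs_def by blast
    from sector_eigen_iff[OF s, of "coef x", THEN iffD1, OF sym this]
    have "?y \<in> ?V" unfolding tri_eigvecs_def mem_Collect_eq
      by (intro exI[of _ "\<lambda>i. coef x i (N - i)"] conjI refl)
    thus "?y \<in> cvec.span B" using B(5) by blast
    show "\<forall>k l. coef ?y k l = (if k + l = N then coef x k l else 0)"
    proof (intro allI)
      fix k l
      have "coef x k l = 0" if "k + l = N" "\<not> k < ?n" "\<not> l < ?n"
      proof -
        have "k = l" "s = - 1" using that s by (auto simp: sector_size_def split: if_splits)
        thus ?thesis using sym[of k k] by simp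
      qed
      moreover have "complex_of_real s * coef x l k = coef x k l" by (rule sym[symmetric])
      ultimately show "coef ?y k l = (if k + l = N then coef x k l else 0)"
        unfolding coef_sum_sector_vec[OF s] by auto
    qed
  qed
  show ?thesis
  proof (intro exI[of _ B] conjI B(1-3) sub)
    show "\<forall>x\<in>B. \<forall>k l. k + l \<noteq> N \<longrightarrow> coef x k l = 0"
      by (intro ballI allI impI) (rule hom[OF subsetD[OF B(4)]])
  qed (intro ballI proj)
qed

text \<open>A vector with coefficients in a single sector is a finite combination of the
  \<open>E i j\<close> there, so the inner product can be evaluated termwise.\<close>

lemma coef_eq_0_imp_cinner_eq_0:
  assumes "\<And>k l. k + l \<noteq> M \<Longrightarrow> coef x k l = 0" "\<And>k l. k + l \<noteq> N \<Longrightarrow> coef y k l = 0" "M \<noteq> N"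
  shows "cinner x y = 0"
proof -
  define z where "z = (\<Sum>i\<le>N. scaleC (coef y i (N - i)) (E i (N - i)))"
  have "coef z k l = coef y k l" for k l
  proof -
    have "coef z k l = (\<Sum>i\<le>N. if i = k then if k + l = N then coef y k l else 0 else 0)"
      unfolding z_def coef_linear coef_E
    proof (intro sum.cong refl)
      fix i assume "i \<in> {..N}"
      hence "i = k \<Longrightarrow> N - i = l \<longleftrightarrow> k + l = N" by auto
      thus "coef y i (N - i) * (if i = k \<and> N - i = l then 1 else 0) =
          (if i = k then if k + l = N then coef y k l else 0 else 0)"
        by (cases "i = k \<and> N - i = l") auto
    qed
    also have "\<dots> = (if k + l = N then coef y k l else 0)" by simp
    finally show ?thesis using assms(2)[of k l] by simp
  qed
  hence "y = z" by (intro coef_eqI) simp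
  moreover have "cinner x (E i (N - i)) = 0" if "i \<le> N" for i
    using assms(1)[of i "N - i"] assms(3) that by (simp add: coef_def)
  hence "cinner x z = 0" by (simp add: z_def cinner_sum_right cinner_scaleC_right)
  ultimately show ?thesis by simp
qed

text \<open>The bases of the sectors are mutually orthogonal. They are kept as a family indexed by
  the sector, because the comparison with the roots is made sector by sector.\<close>

lemma cdimension_eigvecs:
  assumes w: "\<And>i. 0 \<le> w i" and s: "s = 1 \<or> s = - 1"
  obtains B :: "nat \<Rightarrow> 't set" where "\<And>N. finite (B N)" "\<And>N. card (B N) = order \<mu> (sector_poly s w N)"
    "\<And>M N. M \<noteq> N \<Longrightarrow> B M \<inter> B N = {}" "cdimension (eigvecs w s \<mu>) = ecard (\<Union>N. B N)"
proof -
  define Q where "Q N B \<longleftrightarrow> finite B \<and> card B = order \<mu> (sector_poly s w N) \<and>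
      orthogonal_set B \<and> B \<subseteq> eigvecs w s \<mu> \<and>
      (\<forall>x\<in>B. \<forall>k l. k + l \<noteq> N \<longrightarrow> coef x k l = 0) \<and>
      (\<forall>x\<in>eigvecs w s \<mu>. \<exists>y\<in>cvec.span B. \<forall>k l. coef y k l = (if k + l = N then coef x k l else 0))"
    for N B
  have "\<exists>B. Q N B" for N unfolding Q_def by (rule sector_basis[OF w s])
  hence "\<exists>B. \<forall>N. Q N (B N)" by (intro choice allI)
  then obtain B where *: "\<And>N. Q N (B N)" by blast
  have B: "finite (B N)" "card (B N) = order \<mu> (sector_poly s w N)"
    "orthogonal_set (B N)" "B N \<subseteq> eigvecs w s \<mu>" for N
    using *[of N] unfolding Q_def by blast+
  have hom: "coef x k l = 0" if "x \<in> B N" "k + l \<noteq> N" for N x k l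
    using *[of N] that unfolding Q_def by blast
  have proj: "\<exists>y\<in>cvec.span (B N). \<forall>k l. coef y k l = (if k + l = N then coef x k l else 0)"
    if "x \<in> eigvecs w s \<mu>" for N x
    using *[of N] that unfolding Q_def by blast
  have cross: "cinner x y = 0" if "x \<in> B M" "y \<in> B N" "M \<noteq> N" for x y M N
    using coef_eq_0_imp_cinner_eq_0[OF hom[OF that(1)] hom[OF that(2)] that(3)] .
  have disj: "B M \<inter> B N = {}" if "M \<noteq> N" for M N
    by (rule orthogonal_set_Un(2)[OF B(3) B(3) cross[OF _ _ that]])
  have dim: "cdimension (eigvecs w s \<mu>) = ecard (\<Union>N. B N)"
  proof (rule cdimension_orthogonal_basis)
    have "cinner u v = 0" if "u \<in> B M" "v \<in> B N" "u \<noteq> v" for u v M N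
      using that cross[OF that(1,2)] B(3)[of N] unfolding orthogonal_set_def by (cases "M = N") auto
    moreover have "0 \<notin> (\<Union>N. B N)" using B(3) by (auto simp: orthogonal_set_def)
    ultimately show "orthogonal_set (\<Union>N. B N)" unfolding orthogonal_set_def by blast
    show "(\<Union>N. B N) \<subseteq> eigvecs w s \<mu>" using B(4) by blast
    assume fin: "finite (\<Union>N. B N)"
    define I where "I = {N. B N \<noteq> {}}"
    \<comment> \<open>Choosing one vector from each nonempty \<open>B N\<close> is injective by
      disjointness, so only finitely many sectors contribute.\<close>
    have "finite I"
    proof -
      define g where "g N = (SOME v. v \<in> B N)" for N
      have g: "g N \<in> B N" if "N \<in> I" for N
        using that unfolding g_def I_def by (simp add: some_in_eq)
      have "inj_on g I"
      proof (rule inj_onI, rule ccontr)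
        fix M N assume "M \<in> I" "N \<in> I" "g M = g N" "M \<noteq> N"
        thus False using g[of M] g[of N] disj[of M N] by auto
      qed
      moreover have "finite (g ` I)"
        by (rule finite_subset[OF _ fin]) (use g in blast)
      ultimately show ?thesis by (rule finite_imageD[rotated])
    qed
    show "eigvecs w s \<mu> \<subseteq> cvec.span (\<Union>N. B N)"
    proof
      fix x assume x: "x \<in> eigvecs w s \<mu>"
      obtain y where y: "\<And>N. y N \<in> cvec.span (B N)"
        "\<And>N k l. coef (y N) k l = (if k + l = N then coef x k l else 0)"
      proof -
        have "\<exists>y. y \<in> cvec.span (B N) \<and> (\<forall>k l. coef y k l = (if k + l = N then coef x k l else 0))" for N
          using proj[OF x, of N] by blast
        hence "\<exists>y. \<forall>N. y N \<in> cvec.span (B N) \<and>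
            (\<forall>k l. coef (y N) k l = (if k + l = N then coef x k l else 0))"
          by (intro choice allI)
        thus ?thesis using that by blast
      qed
      have "x = (\<Sum>N\<in>I. y N)"
      proof (rule coef_eqI)
        fix k l
        \<comment> \<open>For such a sector the basis is empty, so the component of \<open>x\<close>
          in its span is 0.\<close>
        have "coef x k l = 0" if "k + l \<notin> I"
          using that y(1)[of "k + l"] y(2)[of "k + l" k l] by (simp add: I_def coef_linear)
        thus "coef x k l = coef (\<Sum>N\<in>I. y N) k l"
          using \<open>finite I\<close> by (simp add: coef_linear y(2))
      qed
      moreover have "y N \<in> cvec.span (\<Union>N. B N)" for N
        using y(1)[of N] cvec.span_mono[of "B N" "\<Union>N. B N"] by blast
      ultimately show "x \<in> cvec.span (\<Union>N. B N)" by (simp add: cvec.span_sum)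
    qed
  qed
  from that[OF B(1,2) disj dim] show thesis .
qed

end

section \<open>Matching eigenvectors with roots\<close>

lemma card_roots:
  fixes m :: nat
  assumes "image_mset r (mset_set {1..m}) = proots P" "P \<noteq> 0"
  shows "card {i\<in>{1..m}. r i = \<mu>} = order \<mu> P"
proof -
  have "card {i\<in>{1..m}. r i = \<mu>} = count (image_mset r (mset_set {1..m})) \<mu>"
    by (rule count_image_mset_eq_card_vimage[symmetric]) simp
  thus ?thesis using assms by simp
qed

lemma sector_poly_nonzero: "sector_poly s w N \<noteq> 0"
  unfolding sector_poly_def by (rule jac_nonzero)

text \<open>The roots with superscript \<open>j\<close> belong to sector \<open>N = j - 1\<close>;
  the names \<open>even\<close> and \<open>odd\<close> refer to \<open>j\<close>. The odd case is
  stated with \<open>sector_poly\<close> and \<open>sector_size\<close>, since the number of roots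
  then depends on the sign.\<close>

lemma sector_roots_card:
  assumes s: "s = 1 \<or> s = - 1"
    and even: "\<And>n. n \<ge> 1 \<Longrightarrow> image_mset (r (2 * n)) (mset_set {1..n}) = proots (C_poly s w n)"
    and odd: "\<And>n. n \<ge> 1 \<Longrightarrow> image_mset (r (2 * n + 1)) (mset_set {1..sector_size s (2 * n)}) =
      proots (sector_poly s w (2 * n))"
    and N: "N \<ge> 1"
  shows "card {i\<in>{1..sector_size s N}. r (N + 1) i = \<mu>} = order \<mu> (sector_poly s w N)"
proof (rule card_roots)
  show "image_mset (r (N + 1)) (mset_set {1..sector_size s N}) = proots (sector_poly s w N)"
  proof (cases "even N")
    case True
    then obtain n where "N = 2 * n" "n \<ge> 1" using N by (auto elim!: evenE)
    thus ?thesis using odd[of n] by simp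
  next
    case False
    then obtain m where m: "N = 2 * m + 1" by (auto elim!: oddE)
    define n where "n = Suc m"
    have n: "N = 2 * n - 1" "N + 1 = 2 * n" "n \<ge> 1" using m by (simp_all add: n_def)
    have "sector_size s N = n" using s m by (auto simp: sector_size_def n_def)
    thus ?thesis
      unfolding n(2) using even[OF n(3)] sector_poly_odd[OF n(3) s, of w] n(1) by simp
  qed
qed (rule sector_poly_nonzero)

theorem theorem3p3:
  fixes w :: "nat \<Rightarrow> real"
    and tns :: "hardy \<Rightarrow> hardy \<Rightarrow> 't::complex_hilbert"
    and p q :: "nat \<Rightarrow> nat \<Rightarrow> complex"
  assumes "\<forall>i. 0 \<le> w i"
    and "bounded (range w)"
    and "hilbert_tensor tns"
    and "\<forall>n\<ge>1. image_mset (p (2 * n)) (mset_set {1..n}) = proots (C_plus w n)"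
    and "\<forall>n\<ge>1. image_mset (q (2 * n)) (mset_set {1..n}) = proots (C_minus w n)"
    and "\<forall>n\<ge>1. image_mset (p (2 * n + 1)) (mset_set {1..n + 1}) = proots (G_plus w n)"
    and "\<forall>n\<ge>1. image_mset (q (2 * n + 1)) (mset_set {1..n}) = proots (G_minus w n)"
  shows "point_spectrum (sym_space tns)
            (sym_op tns (weighted_shift w) (adjoint_op (weighted_shift w))) =
          emset_union
            (family_emset (\<lambda>(j, i). p j i) {(j, i). 2 \<le> j \<and> 1 \<le> i \<and> i \<le> (j + 1) div 2})
            (family_emset (\<lambda>x. x) {0})
       \<and> point_spectrum (antisym_space tns)
            (antisym_op tns (weighted_shift w) (adjoint_op (weighted_shift w))) =
          family_emset (\<lambda>(j, i). q j i) {(j, i). 2 \<le> j \<and> 1 \<le> i \<and> i \<le> j div 2}"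
proof -
  interpret hardy_tensor tns by unfold_locales (rule assms(3))
  \<comment> \<open>The index pairs \<open>(j, i)\<close> with \<open>j = N + 1\<close> whose root
    is \<open>\<mu>\<close>. Sector 0 gets none, because the indexing of the roots starts at
    \<open>j = 2\<close>.\<close>
  define R where "R s r \<mu> N = (if N = 0 then {} else
    Pair (N + 1) ` {i\<in>{1..sector_size s N}. r (N + 1) i = \<mu>})" for s and r :: "nat \<Rightarrow> nat \<Rightarrow> complex" and \<mu> N
  have R: "finite (R s r \<mu> N)" "M \<noteq> N \<Longrightarrow> R s r \<mu> M \<inter> R s r \<mu> N = {}"
    "card (R s r \<mu> N) = (if N = 0 then 0 else card {i\<in>{1..sector_size s N}. r (N + 1) i = \<mu>})"
    for s r \<mu> M N
    by (auto simp: R_def card_image inj_on_def)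
  have p: "card {i\<in>{1..sector_size 1 N}. p (N + 1) i = \<mu>} = order \<mu> (sector_poly 1 w N)" if "N \<ge> 1" for N \<mu>
    by (rule sector_roots_card[OF _ _ _ that])
       (use assms(4,6) in \<open>auto simp: sector_size_def sector_poly_even_plus\<close>)
  have q: "card {i\<in>{1..sector_size (- 1) N}. q (N + 1) i = \<mu>} = order \<mu> (sector_poly (- 1) w N)"
    if "N \<ge> 1" for N \<mu>
    by (rule sector_roots_card[OF _ _ _ that])
       (use assms(5,7) in \<open>auto simp: sector_size_def sector_poly_even_minus\<close>)
  have "point_spectrum (sym_space tns) (sym_op tns (weighted_shift w) (adjoint_op (weighted_shift w))) \<mu> =
      emset_union
        (family_emset (\<lambda>(j, i). p j i) {(j, i). 2 \<le> j \<and> 1 \<le> i \<and> i \<le> (j + 1) div 2})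
        (family_emset (\<lambda>x. x) {0}) \<mu>" for \<mu>
  proof -
    obtain B :: "nat \<Rightarrow> 't set" where B: "\<And>N. finite (B N)" "\<And>N. card (B N) = order \<mu> (sector_poly 1 w N)"
      "\<And>M N. M \<noteq> N \<Longrightarrow> B M \<inter> B N = {}" and dim: "cdimension (eigvecs w 1 \<mu>) = ecard (\<Union>N. B N)"
    proof (rule cdimension_eigvecs[where w = w and \<mu> = \<mu>, OF assms(1)[rule_format] disjI1[OF refl]])
      fix B :: "nat \<Rightarrow> 't set"
      assume "\<And>N. finite (B N)" "\<And>N. card (B N) = order \<mu> (sector_poly 1 w N)"
        "\<And>M N. M \<noteq> N \<Longrightarrow> B M \<inter> B N = {}" "cdimension (eigvecs w 1 \<mu>) = ecard (\<Union>N. B N)"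
      thus thesis by (rule that)
    qed
    \<comment> \<open>Sector 0 is split off: it has no counterpart among the roots and is matched
      with the adjoined 0.\<close>
    define B' where "B' N = (if N = 0 then {} else B N)" for N
    have U: "(\<Union>N. B N) = (\<Union>N. B' N) \<union> B 0"
    proof
      have "B N \<subseteq> B' N \<union> B 0" for N by (cases "N = 0") (simp_all add: B'_def)
      thus "(\<Union>N. B N) \<subseteq> (\<Union>N. B' N) \<union> B 0" by blast
      have "B' N \<subseteq> B N" for N by (simp add: B'_def)
      thus "(\<Union>N. B' N) \<union> B 0 \<subseteq> (\<Union>N. B N)" by blast
    qed
    have "B' N \<inter> B 0 = {}" for N using B(3)[of N 0] by (auto simp: B'_def)
    hence "ecard (\<Union>N. B N) = ecard (\<Union>N. B' N) + ecard (B 0)"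
      unfolding U by (intro ecard_Un_disjoint) blast
    also have "ecard (\<Union>N. B' N) = ecard (\<Union>N. R 1 p \<mu> N)"
      by (rule ecard_UN_eq) (use B R p in \<open>auto simp: B'_def\<close>)
    also have "(\<Union>N. R 1 p \<mu> N) = {x \<in> {(j, i). 2 \<le> j \<and> 1 \<le> i \<and> i \<le> (j + 1) div 2}. (\<lambda>(j, i). p j i) x = \<mu>}"
    proof (intro set_eqI iffI)
      fix x assume "x \<in> {x \<in> {(j, i). 2 \<le> j \<and> 1 \<le> i \<and> i \<le> (j + 1) div 2}. (\<lambda>(j, i). p j i) x = \<mu>}"
      then obtain j i where "x = (j, i)" "2 \<le> j" "1 \<le> i" "i \<le> (j + 1) div 2" "p j i = \<mu>" by auto
      hence "x \<in> R 1 p \<mu> (j - 1)" by (auto simp: R_def sector_size_def)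
      thus "x \<in> (\<Union>N. R 1 p \<mu> N)" by blast
    qed (auto simp: R_def sector_size_def split: if_splits)
    also have "ecard (B 0) = ecard {x \<in> {0}. x = \<mu>}"
      using B(1)[of 0] B(2)[of 0] by (auto simp: ecard_def order_sector_poly_0 one_enat_def)
    finally show ?thesis
      unfolding point_spectrum_eq(1)[OF assms(2)] dim emset_union_def family_emset_def .
  qed
  moreover have "point_spectrum (antisym_space tns)
        (antisym_op tns (weighted_shift w) (adjoint_op (weighted_shift w))) \<mu> =
      family_emset (\<lambda>(j, i). q j i) {(j, i). 2 \<le> j \<and> 1 \<le> i \<and> i \<le> j div 2} \<mu>" for \<mu>
  proof -
    obtain B :: "nat \<Rightarrow> 't set" where B: "\<And>N. finite (B N)" "\<And>N. card (B N) = order \<mu> (sector_poly (- 1) w N)"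
      "\<And>M N. M \<noteq> N \<Longrightarrow> B M \<inter> B N = {}" and dim: "cdimension (eigvecs w (- 1) \<mu>) = ecard (\<Union>N. B N)"
    proof (rule cdimension_eigvecs[where w = w and \<mu> = \<mu>, OF assms(1)[rule_format] disjI2[OF refl]])
      fix B :: "nat \<Rightarrow> 't set"
      assume "\<And>N. finite (B N)" "\<And>N. card (B N) = order \<mu> (sector_poly (- 1) w N)"
        "\<And>M N. M \<noteq> N \<Longrightarrow> B M \<inter> B N = {}" "cdimension (eigvecs w (- 1) \<mu>) = ecard (\<Union>N. B N)"
      thus thesis by (rule that)
    qed
    \<comment> \<open>The antisymmetric sector 0 is the zero space and its matrix is empty, so
      nothing has to be split off.\<close>
    have "sector_poly (- 1) w 0 = 1" by (simp add: sector_poly_def sector_size_def)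
    hence "order \<mu> (sector_poly (- 1) w 0) = 0" by (simp add: order_root)
    hence "ecard (\<Union>N. B N) = ecard (\<Union>N. R (- 1) q \<mu> N)"
      by (intro ecard_UN_eq) (use B R q in auto)
    also have "(\<Union>N. R (- 1) q \<mu> N) = {x \<in> {(j, i). 2 \<le> j \<and> 1 \<le> i \<and> i \<le> j div 2}. (\<lambda>(j, i). q j i) x = \<mu>}"
    proof (intro set_eqI iffI)
      fix x assume "x \<in> {x \<in> {(j, i). 2 \<le> j \<and> 1 \<le> i \<and> i \<le> j div 2}. (\<lambda>(j, i). q j i) x = \<mu>}"
      then obtain j i where "x = (j, i)" "2 \<le> j" "1 \<le> i" "i \<le> j div 2" "q j i = \<mu>" by auto
      hence "x \<in> R (- 1) q \<mu> (j - 1)" by (auto simp: R_def sector_size_def)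
      thus "x \<in> (\<Union>N. R (- 1) q \<mu> N)" by blast
    qed (auto simp: R_def sector_size_def split: if_splits)
    finally show ?thesis
      unfolding point_spectrum_eq(2)[OF assms(2)] dim family_emset_def .
  qed
  ultimately show ?thesis by blast
qed

end
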